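(* For any pure state $|\psi\rangle^{ABC}$ of a tripartite quantum system $ABC$, with reduced states $\rho^{AB}=\mathrm{Tr}_C|\psi\rangle\langle\psi|^{ABC}$ and $\rho^{BC}=\mathrm{Tr}_A|\psi\rangle\langle\psi|^{ABC}$, it holds that $$F_{\rightarrow}^{A|B}(\rho^{AB})+E_g(\rho^{BC})=1 .$$
   Context: $F_{\rightarrow}^{A|B}(\rho^{AB})$ is the maximal fidelity with the ground state that Bob (holding $B$) can achieve when Alice (holding $A$) assists him with classical communication from Alice to Bob only, the local Hamiltonians being fully degenerate. It is given by $F_{\rightarrow}^{A|B}(\rho^{AB})=\max\sum_i\mathrm{Tr}[(M_i^A\otimes\mu_i^B)\rho^{AB}]$, with the maximum over all POVMs $\{M_i^A\}$ on $A$ and all families of quantum states $\{\mu_i^B\}$ on $B$. Equivalently, it is the maximum of $\sum_i p_i\lambda_{\max}(\sigma_i^B)$ over POVMs $\{M_i^A\}$ on $A$, where $p_i=\mathrm{Tr}[(M_i^A\otimes\mathbb{1}^B)\rho^{AB}]$, $\sigma_i^B=\mathrm{Tr}_A[(M_i^A\otimes\mathbb{1}^B)\rho^{AB}]/p_i$ and $\lambda_{\max}$ is the largest eigenvalue. Geometric entanglement: for a pure bipartite state $|\phi\rangle^{BC}$ with $\phi=|\phi\rangle\langle\phi|$, $E_g(\phi)=1-\max|\langle\chi|\phi\rangle|^2$, the maximum being over all normalized product vectors $|\chi\rangle=|\chi_1\rangle^B\otimes|\chi_2\rangle^C$. For a mixed state $\rho^{BC}$, $E_g(\rho^{BC})=\min\sum_i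 p_iE_g(\psi_i)$, the minimum being over all pure state decompositions $\rho^{BC}=\sum_i p_i|\psi_i\rangle\langle\psi_i|$ with probabilities $p_i$ and normalized $|\psi_i\rangle$. No restriction is placed on the dimensions of $A$, $B$, $C$; the relation is also asserted for infinite-dimensional systems. *)

theory Defs
  imports "HOL-Analysis.Analysis"
begin

text \<open>
  Up to the choice of an orthonormal basis indexed by \<open>'a\<close>, every complex Hilbert space
  (of finite or infinite, possibly uncountable, dimension) is the space \<open>'a ell2\<close> of square-summable
  families, and the Hilbert tensor product of \<open>'a ell2\<close> and \<open>'b ell2\<close> is \<open>('a \<times> 'b) ell2\<close>.
\<close>

typedef 'a ell2 = "{x :: 'a \<Rightarrow> complex. (\<lambda>i. (cmod (x i))\<^sup>2) summable_on UNIV}"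
  morphisms coord Abs_ell2
  by (rule exI[of _ "\<lambda>_. 0"]) simp

setup_lifting type_definition_ell2

lemma sq_summable_add:
  fixes x y :: "'a \<Rightarrow> complex"
  assumes "(\<lambda>i. (cmod (x i))\<^sup>2) summable_on UNIV" "(\<lambda>i. (cmod (y i))\<^sup>2) summable_on UNIV"
  shows "(\<lambda>i. (cmod (x i + y i))\<^sup>2) summable_on UNIV"
proof (rule summable_on_comparison_test)
  show "(\<lambda>i. 2 * ((cmod (x i))\<^sup>2 + (cmod (y i))\<^sup>2)) summable_on UNIV"
    by (intro summable_on_cmult_right summable_on_add assms)
  show "(cmod (x i + y i))\<^sup>2 \<le> 2 * ((cmod (x i))\<^sup>2 + (cmod (y i))\<^sup>2)" for i
  proof -
    have "(cmod (x i + y i))\<^sup>2 \<le> (cmod (x i) + cmod (y i))\<^sup>2"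
      by (intro power_mono norm_triangle_ineq) simp
    also have "\<dots> \<le> 2 * ((cmod (x i))\<^sup>2 + (cmod (y i))\<^sup>2)"
      using sum_squares_bound[of "cmod (x i)" "cmod (y i)"] by (simp add: power2_sum)
    finally show ?thesis .
  qed
qed auto

lemma sq_summable_mult:
  fixes x :: "'a \<Rightarrow> complex"
  assumes "(\<lambda>i. (cmod (x i))\<^sup>2) summable_on UNIV"
  shows "(\<lambda>i. (cmod (c * x i))\<^sup>2) summable_on UNIV"
  using summable_on_cmult_right[OF assms, of "(cmod c)\<^sup>2"]
  by (simp add: norm_mult power_mult_distrib)

lemma sq_summable_inner:
  fixes x y :: "'a \<Rightarrow> complex"
  assumes "(\<lambda>i. (cmod (x i))\<^sup>2) summable_on UNIV" "(\<lambda>i. (cmod (y i))\<^sup>2) summable_on UNIV"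
  shows "(\<lambda>i. cnj (x i) * y i) summable_on UNIV"
proof (rule Infinite_Sum.abs_summable_summable, rule Infinite_Sum.abs_summable_on_comparison_test'[where g = "\<lambda>i. (cmod (x i))\<^sup>2 + (cmod (y i))\<^sup>2"])
  show "(\<lambda>i. (cmod (x i))\<^sup>2 + (cmod (y i))\<^sup>2) summable_on UNIV"
    by (intro summable_on_add assms)
  show "norm (cnj (x i) * y i) \<le> (cmod (x i))\<^sup>2 + (cmod (y i))\<^sup>2" for i
    using sum_squares_bound[of "cmod (x i)" "cmod (y i)"]
      mult_nonneg_nonneg[OF norm_ge_zero[of "x i"] norm_ge_zero[of "y i"]]
    unfolding norm_mult complex_mod_cnj by linarith
qed

lemma coord_sq_summable: "(\<lambda>i. (cmod (coord x i))\<^sup>2) summable_on UNIV"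
  using coord[of x] by simp

lift_definition scaleC :: "complex \<Rightarrow> 'a ell2 \<Rightarrow> 'a ell2" (infixr "*\<^sub>C" 75)
  is "\<lambda>c x i. c * x i"
  by (rule sq_summable_mult)

lift_definition cinner :: "'a ell2 \<Rightarrow> 'a ell2 \<Rightarrow> complex"
  is "\<lambda>x y. \<Sum>\<^sub>\<infinity>i. cnj (x i) * y i" .

lemma cinner_self: "cinner x x = of_real (\<Sum>\<^sub>\<infinity>i. (cmod (coord x i))\<^sup>2)"
proof -
  have "((\<lambda>i. of_real ((cmod (coord x i))\<^sup>2) :: complex) has_sum
      of_real (\<Sum>\<^sub>\<infinity>i. (cmod (coord x i))\<^sup>2)) UNIV"
    by (rule has_sum_of_real[OF has_sum_infsum[OF coord_sq_summable]])
  then show ?thesis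
    unfolding cinner.rep_eq
    by (intro infsumI) (simp add: complex_norm_square mult.commute[of "cnj _"] del: of_real_power)
qed

instantiation ell2 :: (type) real_vector
begin

lift_definition zero_ell2 :: "'a ell2" is "\<lambda>_. 0" by simp

lift_definition plus_ell2 :: "'a ell2 \<Rightarrow> 'a ell2 \<Rightarrow> 'a ell2" is "\<lambda>x y i. x i + y i"
  by (rule sq_summable_add)

lift_definition uminus_ell2 :: "'a ell2 \<Rightarrow> 'a ell2" is "\<lambda>x i. - x i" by simp

lift_definition minus_ell2 :: "'a ell2 \<Rightarrow> 'a ell2 \<Rightarrow> 'a ell2" is "\<lambda>x y i. x i - y i"
proof -
  fix x y :: "'a \<Rightarrow> complex"
  assume "(\<lambda>i. (cmod (x i))\<^sup>2) summable_on UNIV" "(\<lambda>i. (cmod (y i))\<^sup>2) summable_on UNIV"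
  then show "(\<lambda>i. (cmod (x i - y i))\<^sup>2) summable_on UNIV"
    using sq_summable_add[of x "\<lambda>i. - y i"] by simp
qed

lift_definition scaleR_ell2 :: "real \<Rightarrow> 'a ell2 \<Rightarrow> 'a ell2" is "\<lambda>r x i. r *\<^sub>R x i"
  by (simp only: scaleR_conv_of_real) (rule sq_summable_mult)

instance
proof
  fix x y z :: "'a ell2" and r s :: real
  show "x + y + z = x + (y + z)" by transfer (simp add: add.assoc)
  show "x + y = y + x" by transfer (simp add: add.commute)
  show "0 + x = x" by transfer simp
  show "- x + x = 0" by transfer simp
  show "x - y = x + - y" by transfer simp
  show "r *\<^sub>R (x + y) = r *\<^sub>R x + r *\<^sub>R y" by transfer (simp add: scaleR_add_right)
  show "(r + s) *\<^sub>R x = r *\<^sub>R x + s *\<^sub>R x" by transfer (simp add: scaleR_add_left)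
  show "r *\<^sub>R s *\<^sub>R x = (r * s) *\<^sub>R x" by transfer simp
  show "1 *\<^sub>R x = x" by transfer simp
qed

end

instantiation ell2 :: (type) real_inner
begin

definition inner_ell2 :: "'a ell2 \<Rightarrow> 'a ell2 \<Rightarrow> real" where
  "inner_ell2 x y = Re (cinner x y)"

definition norm_ell2 :: "'a ell2 \<Rightarrow> real" where
  "norm_ell2 x = sqrt (inner x x)"

definition sgn_ell2 :: "'a ell2 \<Rightarrow> 'a ell2" where
  "sgn_ell2 x = x /\<^sub>R norm x"

definition dist_ell2 :: "'a ell2 \<Rightarrow> 'a ell2 \<Rightarrow> real" where
  "dist_ell2 x y = norm (x - y)"

definition uniformity_ell2 :: "('a ell2 \<times> 'a ell2) filter" where
  "uniformity_ell2 = (INF e\<in>{0<..}. principal {(x, y). dist x y < e})"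

definition open_ell2 :: "'a ell2 set \<Rightarrow> bool" where
  "open_ell2 U = (\<forall>x\<in>U. eventually (\<lambda>(x', y). x' = x \<longrightarrow> y \<in> U) uniformity)"

instance
proof
  fix x y z :: "'a ell2" and r :: real
  show "dist x y = norm (x - y)" by (rule dist_ell2_def)
  show "sgn x = x /\<^sub>R norm x" by (rule sgn_ell2_def)
  show "uniformity = (INF e\<in>{0<..}. principal {(x :: 'a ell2, y). dist x y < e})"
    by (rule uniformity_ell2_def)
  show "open U = (\<forall>x\<in>U. eventually (\<lambda>(x', y). x' = x \<longrightarrow> y \<in> U) uniformity)" for U :: "'a ell2 set"
    by (rule open_ell2_def)
  show "norm x = sqrt (inner x x)" by (rule norm_ell2_def)
  have "cinner y x = cnj (cinner x y)"
    unfolding cinner.rep_eq infsum_cnj[symmetric] by (simp add: mult.commute)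
  then show "inner x y = inner y x" by (simp add: inner_ell2_def)
  have "cinner (x + y) z = cinner x z + cinner y z"
    by (simp add: cinner.rep_eq plus_ell2.rep_eq distrib_right infsum_add
        sq_summable_inner coord_sq_summable)
  then show "inner (x + y) z = inner x z + inner y z" by (simp add: inner_ell2_def)
  have "cinner (r *\<^sub>R x) y = r *\<^sub>R cinner x y"
    by (simp add: cinner.rep_eq scaleR_ell2.rep_eq scaleR_conv_of_real mult.assoc infsum_cmult_right')
  then show "inner (r *\<^sub>R x) y = r * inner x y" by (simp add: inner_ell2_def)
  show "0 \<le> inner x x"
    by (simp add: inner_ell2_def cinner_self infsum_nonneg)
  show "inner x x = 0 \<longleftrightarrow> x = 0"
  proof
    assume "inner x x = 0"
    then have *: "(\<Sum>\<^sub>\<infinity>i. (cmod (coord x i))\<^sup>2) = 0"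
      by (simp add: inner_ell2_def cinner_self)
    have "(cmod (coord x i))\<^sup>2 = 0" for i
      by (rule nonneg_infsum_le_0D[OF _ coord_sq_summable[of x], of i]) (simp_all add: *)
    then have "coord x = coord 0"
      by (intro ext) (simp add: zero_ell2.rep_eq)
    then show "x = 0" by (simp only: coord_inject)
  next
    assume "x = 0"
    then show "inner x x = 0" by (simp add: inner_ell2_def cinner.rep_eq zero_ell2.rep_eq)
  qed
qed

end

lemma norm_ell2_sq: "(norm x)\<^sup>2 = (\<Sum>\<^sub>\<infinity>i. (cmod (coord x i))\<^sup>2)"
  by (simp add: power2_norm_eq_inner inner_ell2_def cinner_self)

lemma norm_ell2_finite_sum:
  assumes "finite F"
  shows "(\<Sum>i\<in>F. (cmod (coord x i))\<^sup>2) \<le> (norm x)\<^sup>2"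
  unfolding norm_ell2_sq
  by (rule finite_sum_le_infsum[OF coord_sq_summable assms]) auto

instance ell2 :: (type) banach
proof
  fix X :: "nat \<Rightarrow> 'a ell2"
  assume X: "Cauchy X"
  have co: "cmod (coord x i) \<le> norm x" for x :: "'a ell2" and i
    using norm_ell2_finite_sum[of "{i}" x] by (simp add: power2_le_iff_abs_le)
  have "Cauchy (\<lambda>n. coord (X n) i)" for i
  proof (rule metric_CauchyI)
    fix e :: real assume "0 < e"
    then obtain N where N: "\<And>m n. m \<ge> N \<Longrightarrow> n \<ge> N \<Longrightarrow> dist (X m) (X n) < e"
      using metric_CauchyD[OF X] by blast
    have "dist (coord (X m) i) (coord (X n) i) < e" if "m \<ge> N" "n \<ge> N" for m n
      using co[of "X m - X n" i] N[OF that] by (simp add: dist_norm minus_ell2.rep_eq)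
    then show "\<exists>N. \<forall>m\<ge>N. \<forall>n\<ge>N. dist (coord (X m) i) (coord (X n) i) < e"
      by blast
  qed
  then have "\<exists>l. (\<lambda>n. coord (X n) i) \<longlonglongrightarrow> l" for i
    using Cauchy_convergent convergent_def by blast
  then obtain l where l: "\<And>i. (\<lambda>n. coord (X n) i) \<longlonglongrightarrow> l i" by metis
  have fin: "(\<Sum>i\<in>F. (cmod (coord (X n) i - l i))\<^sup>2) \<le> e\<^sup>2"
    if "finite F" "n \<ge> N" "0 < e" and N: "\<And>m n. m \<ge> N \<Longrightarrow> n \<ge> N \<Longrightarrow> dist (X m) (X n) < e"
    for F n N and e :: real
  proof (rule LIMSEQ_le_const2)
    show "(\<lambda>m. \<Sum>i\<in>F. (cmod (coord (X n) i - coord (X m) i))\<^sup>2)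
        \<longlonglongrightarrow> (\<Sum>i\<in>F. (cmod (coord (X n) i - l i))\<^sup>2)"
      by (intro tendsto_intros l)
    have "(\<Sum>i\<in>F. (cmod (coord (X n) i - coord (X m) i))\<^sup>2) \<le> e\<^sup>2" if "m \<ge> N" for m
    proof -
      have "(\<Sum>i\<in>F. (cmod (coord (X n) i - coord (X m) i))\<^sup>2) \<le> (norm (X n - X m))\<^sup>2"
        using norm_ell2_finite_sum[OF \<open>finite F\<close>, of "X n - X m"] by (simp add: minus_ell2.rep_eq)
      also have "\<dots> \<le> e\<^sup>2"
        using N[OF \<open>n \<ge> N\<close> that] by (intro power_mono) (auto simp: dist_norm)
      finally show ?thesis .
    qed
    then show "\<exists>N. \<forall>m\<ge>N. (\<Sum>i\<in>F. (cmod (coord (X n) i - coord (X m) i))\<^sup>2) \<le> e\<^sup>2" by blast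
  qed
  have sq: "(\<lambda>i. (cmod (coord (X n) i - l i))\<^sup>2) summable_on UNIV"
    if "n \<ge> N" "0 < e" "\<And>m n. m \<ge> N \<Longrightarrow> n \<ge> N \<Longrightarrow> dist (X m) (X n) < e"
    for n N and e :: real
    by (rule nonneg_bdd_above_summable_on)
      (use fin[OF _ that] in \<open>auto simp: bdd_above_def\<close>)
  obtain N1 where N1: "\<And>m n. m \<ge> N1 \<Longrightarrow> n \<ge> N1 \<Longrightarrow> dist (X m) (X n) < 1"
    using metric_CauchyD[OF X zero_less_one] by blast
  have "(\<lambda>i. (cmod (l i))\<^sup>2) summable_on UNIV"
    using sq_summable_add[OF coord_sq_summable[of "X N1"], of "\<lambda>i. - (coord (X N1) i - l i)"]
      sq[of N1 N1 1] N1 by (simp add: norm_minus_commute)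
  then have L: "coord (Abs_ell2 l) = l" by (simp add: Abs_ell2_inverse)
  have "X \<longlonglongrightarrow> Abs_ell2 l"
  proof (rule metric_LIMSEQ_I)
    fix e :: real assume "0 < e"
    then have e: "0 < e / 2" by simp
    then obtain N where N: "\<And>m n. m \<ge> N \<Longrightarrow> n \<ge> N \<Longrightarrow> dist (X m) (X n) < e / 2"
      using metric_CauchyD[OF X e] by blast
    have "dist (X n) (Abs_ell2 l) < e" if "n \<ge> N" for n
    proof -
      have "(norm (X n - Abs_ell2 l))\<^sup>2 \<le> (e / 2)\<^sup>2"
        unfolding norm_ell2_sq minus_ell2.rep_eq L
        by (rule infsum_le_finite_sums[OF sq[OF that e N]]) (use fin[OF _ that e N] in auto)
      then have "norm (X n - Abs_ell2 l) \<le> e / 2"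
        using e by (simp add: power2_le_iff_abs_le)
      then show ?thesis using e by (simp add: dist_norm)
    qed
    then show "\<exists>N. \<forall>n\<ge>N. dist (X n) (Abs_ell2 l) < e" by blast
  qed
  then show "convergent X" by (auto simp: convergent_def)
qed

lift_definition ket :: "'a \<Rightarrow> 'a ell2" is "\<lambda>a i. if i = a then 1 else 0"
proof -
  fix a :: 'a
  have "(\<lambda>i. (cmod (if i = a then 1 else 0))\<^sup>2) summable_on {a}" by simp
  then show "(\<lambda>i. (cmod (if i = a then 1 else 0))\<^sup>2) summable_on UNIV"
    by (subst summable_on_cong_neutral[where T = "{a}"]) auto
qed

lift_definition tensor :: "'a ell2 \<Rightarrow> 'b ell2 \<Rightarrow> ('a \<times> 'b) ell2" (infixr "\<otimes>\<^sub>v" 70)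
  is "\<lambda>x y (a, b). x a * y b"
proof -
  fix x :: "'a \<Rightarrow> complex" and y :: "'b \<Rightarrow> complex"
  assume x: "(\<lambda>i. (cmod (x i))\<^sup>2) summable_on UNIV" and y: "(\<lambda>i. (cmod (y i))\<^sup>2) summable_on UNIV"
  have "(\<lambda>(a, b). (cmod (x a))\<^sup>2 * (cmod (y b))\<^sup>2) summable_on UNIV \<times> UNIV"
    using x y
    by (intro summable_on_SigmaI[where g = "\<lambda>a. (cmod (x a))\<^sup>2 * (\<Sum>\<^sub>\<infinity>b. (cmod (y b))\<^sup>2)"])
      (auto intro!: has_sum_cmult_right summable_on_cmult_left)
  then show "(\<lambda>i. (cmod (case i of (a, b) \<Rightarrow> x a * y b))\<^sup>2) summable_on UNIV"
    by (simp add: case_prod_unfold norm_mult power_mult_distrib)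
qed

text \<open>\<open>bra_fst a\<close> is the operator \<open>\<langle>a| \<otimes> 1\<close>, and \<open>bra_snd b\<close> is \<open>1 \<otimes> \<langle>b|\<close>.\<close>

lift_definition bra_fst :: "'a \<Rightarrow> ('a \<times> 'b) ell2 \<Rightarrow> 'b ell2" is "\<lambda>a x b. x (a, b)"
proof -
  fix a and x :: "'a \<times> 'b \<Rightarrow> complex"
  assume "(\<lambda>i. (cmod (x i))\<^sup>2) summable_on UNIV"
  then have "(\<lambda>i. (cmod (x i))\<^sup>2) summable_on range (Pair a)"
    by (rule summable_on_subset_banach) simp
  then show "(\<lambda>b. (cmod (x (a, b)))\<^sup>2) summable_on UNIV"
    by (simp add: summable_on_reindex inj_on_def o_def)
qed

lift_definition bra_snd :: "'b \<Rightarrow> ('a \<times> 'b) ell2 \<Rightarrow> 'a ell2" is "\<lambda>b x a. x (a, b)"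
proof -
  fix b and x :: "'a \<times> 'b \<Rightarrow> complex"
  assume "(\<lambda>i. (cmod (x i))\<^sup>2) summable_on UNIV"
  then have "(\<lambda>i. (cmod (x i))\<^sup>2) summable_on range (\<lambda>a. (a, b))"
    by (rule summable_on_subset_banach) simp
  then show "(\<lambda>a. (cmod (x (a, b)))\<^sup>2) summable_on UNIV"
    by (simp add: summable_on_reindex inj_on_def o_def)
qed

lift_definition assoc_ell2 :: "('a \<times> 'b \<times> 'c) ell2 \<Rightarrow> (('a \<times> 'b) \<times> 'c) ell2"
  is "\<lambda>x ((a, b), c). x (a, b, c)"
proof -
  fix x :: "'a \<times> 'b \<times> 'c \<Rightarrow> complex"
  assume x: "(\<lambda>i. (cmod (x i))\<^sup>2) summable_on UNIV"
  have "bij_betw (\<lambda>((a, b), c). (a, b, c)) (UNIV :: (('a \<times> 'b) \<times> 'c) set) UNIV"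
    by (rule bij_betwI[where g = "\<lambda>(a, b, c). ((a, b), c)"]) auto
  from summable_on_reindex_bij_betw[OF this, of "\<lambda>i. (cmod (x i))\<^sup>2"] x
  show "(\<lambda>i. (cmod ((\<lambda>((a, b), c). x (a, b, c)) i))\<^sup>2) summable_on UNIV"
    by (simp add: case_prod_beta)
qed

definition bounded_clinear :: "('a ell2 \<Rightarrow> 'b ell2) \<Rightarrow> bool" where
  "bounded_clinear T \<longleftrightarrow> bounded_linear T \<and> (\<forall>c x. T (c *\<^sub>C x) = c *\<^sub>C T x)"

definition positive_op :: "('a ell2 \<Rightarrow> 'a ell2) \<Rightarrow> bool" where
  "positive_op T \<longleftrightarrow> bounded_clinear T \<and> (\<forall>x. cinner x (T x) \<in> \<real>\<^sub>\<ge>\<^sub>0)"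

definition trace :: "('a ell2 \<Rightarrow> 'a ell2) \<Rightarrow> complex" where
  "trace T = (\<Sum>\<^sub>\<infinity>i. cinner (ket i) (T (ket i)))"

text \<open>The condition \<open>has_sum\<close> contains the convergence of the trace, so that a positive operator
  satisfying it is trace class.\<close>

definition density_op :: "('a ell2 \<Rightarrow> 'a ell2) \<Rightarrow> bool" where
  "density_op \<mu> \<longleftrightarrow> positive_op \<mu> \<and> ((\<lambda>i. cinner (ket i) (\<mu> (ket i))) has_sum 1) UNIV"

definition proj :: "'a ell2 \<Rightarrow> 'a ell2 \<Rightarrow> 'a ell2" where
  "proj \<phi> x = cinner \<phi> x *\<^sub>C \<phi>"

definition ptrace_fst :: "(('a \<times> 'b) ell2 \<Rightarrow> ('a \<times> 'b) ell2) \<Rightarrow> 'b ell2 \<Rightarrow> 'b ell2" where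
  "ptrace_fst T y = (\<Sum>\<^sub>\<infinity>a. bra_fst a (T (ket a \<otimes>\<^sub>v y)))"

definition ptrace_snd :: "(('a \<times> 'b) ell2 \<Rightarrow> ('a \<times> 'b) ell2) \<Rightarrow> 'a ell2 \<Rightarrow> 'a ell2" where
  "ptrace_snd T x = (\<Sum>\<^sub>\<infinity>b. bra_snd b (T (x \<otimes>\<^sub>v ket b)))"

text \<open>For bounded \<open>M\<close> and \<open>N\<close>, \<open>M \<otimes> N\<close> is the bounded linear extension of its values
  \<open>M |a\<rangle> \<otimes> N |b\<rangle>\<close> on the product basis.\<close>

definition tensor_op :: "('a ell2 \<Rightarrow> 'a ell2) \<Rightarrow> ('b ell2 \<Rightarrow> 'b ell2) \<Rightarrow>
    ('a \<times> 'b) ell2 \<Rightarrow> ('a \<times> 'b) ell2" (infixr "\<otimes>\<^sub>o" 70) where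
  "(M \<otimes>\<^sub>o N) x = (\<Sum>\<^sub>\<infinity>(a, b). coord x (a, b) *\<^sub>C (M (ket a) \<otimes>\<^sub>v N (ket b)))"

text \<open>Measurements have countably many outcomes and ensembles countably many members. Finite ones
  are included, by padding with zero operators and zero probabilities. The sums of operators converge
  strongly.\<close>

definition povm :: "(nat \<Rightarrow> 'a ell2 \<Rightarrow> 'a ell2) \<Rightarrow> bool" where
  "povm M \<longleftrightarrow> (\<forall>i. positive_op (M i)) \<and> (\<forall>x. (\<lambda>i. M i x) sums x)"

definition pure_decomposition ::
    "('a ell2 \<Rightarrow> 'a ell2) \<Rightarrow> (nat \<Rightarrow> real) \<Rightarrow> (nat \<Rightarrow> 'a ell2) \<Rightarrow> bool" where
  "pure_decomposition \<rho> p \<phi> \<longleftrightarrow>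
     (\<forall>i. 0 \<le> p i) \<and> p sums 1 \<and> (\<forall>i. norm (\<phi> i) = 1) \<and>
     (\<forall>x. (\<lambda>i. p i *\<^sub>R proj (\<phi> i) x) sums \<rho> x)"

text \<open>Maxima and minima are rendered as suprema and infima, because in infinite dimension the
  optimal value need not be attained by a discrete measurement or ensemble.\<close>

definition fidelity_A_to_B :: "(('a \<times> 'b) ell2 \<Rightarrow> ('a \<times> 'b) ell2) \<Rightarrow> real" where
  "fidelity_A_to_B \<rho> =
     Sup {\<Sum>i. Re (trace ((M i \<otimes>\<^sub>o \<mu> i) \<circ> \<rho>)) | M \<mu>. povm M \<and> (\<forall>i. density_op (\<mu> i))}"

definition geom_ent_pure :: "('b \<times> 'c) ell2 \<Rightarrow> real" where
  "geom_ent_pure \<phi> =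
     1 - Sup {(cmod (cinner (\<chi>\<^sub>1 \<otimes>\<^sub>v \<chi>\<^sub>2) \<phi>))\<^sup>2 | \<chi>\<^sub>1 \<chi>\<^sub>2. norm \<chi>\<^sub>1 = 1 \<and> norm \<chi>\<^sub>2 = 1}"

definition geom_ent :: "(('b \<times> 'c) ell2 \<Rightarrow> ('b \<times> 'c) ell2) \<Rightarrow> real" where
  "geom_ent \<rho> = Inf {\<Sum>i. p i * geom_ent_pure (\<phi> i) | p \<phi>. pure_decomposition \<rho> p \<phi>}"

definition reduced_AB :: "('a \<times> 'b \<times> 'c) ell2 \<Rightarrow> ('a \<times> 'b) ell2 \<Rightarrow> ('a \<times> 'b) ell2" where
  "reduced_AB \<psi> = ptrace_snd (proj (assoc_ell2 \<psi>))"

definition reduced_BC :: "('a \<times> 'b \<times> 'c) ell2 \<Rightarrow> ('b \<times> 'c) ell2 \<Rightarrow> ('b \<times> 'c) ell2" where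
  "reduced_BC \<psi> = ptrace_fst (proj \<psi>)"

end

theory Submission
  imports Defs
begin

text \<open>A measurement on \<open>A\<close> with rank-one elements \<open>|m\<^sub>k\<rangle>\<langle>m\<^sub>k|\<close> leaves \<open>BC\<close> in the unnormalized pure states
  \<open>f\<^sub>k = (\<langle>m\<^sub>k| \<otimes> 1)\<psi>\<close>, which decompose \<open>\<rho>\<^sup>B\<^sup>C\<close>. Conversely, every pure decomposition of \<open>\<rho>\<^sup>B\<^sup>C\<close> arises in
  this way: \<open>y \<mapsto> \<langle>y|f\<^sub>k\<rangle>\<close> is dominated by the norm of \<open>(1 \<otimes> \<langle>y|)\<psi>\<close>, so the Riesz theorem yields \<open>m\<^sub>k\<close>, and
  the \<open>m\<^sub>k\<close> satisfy Bessel's inequality, so that \<open>1 - \<Sum>\<^sub>k |m\<^sub>k\<rangle>\<langle>m\<^sub>k|\<close> completes them to a measurement. Given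
  the outcome \<open>k\<close>, the best state \<open>\<mu>\<^sub>k\<close> contributes the top of the spectrum of \<open>Tr\<^sub>C |f\<^sub>k\<rangle>\<langle>f\<^sub>k|\<close>, which is the
  largest squared overlap of \<open>f\<^sub>k\<close> with a product vector. Measurements that are not of rank one are refined by Cholesky
  factorization of their elements, which needs no spectral theorem.\<close>

section \<open>Iterated sums and coordinates\<close>

text \<open>Two obstacles shape the details. Bases may be uncountable, whereas a Cholesky
  factorization along a sequence exhausts an operator only on the closed span of that sequence. The
  remedy is that every single vector has countable support: the basis vectors in the support can be
  enumerated, and the factorizations are evaluated only on vectors with that support. The second
  obstacle is convergence. Exchanges of sums over outcomes, factors and slices are arranged to
  concern nonnegative terms or terms with a summable majorant, and operator series are controlled
  through their quadratic forms: for positive \<open>T\<close> with form at most \<open>K\<close>,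
  the square of the norm of \<open>T x\<close> is at most K <x|T x>, which turns convergence of
  forms into strong convergence. In the converse direction the vectors m_k are not determined by the
  f_k alone. They have to be chosen in the closure of the vectors (1 tensor <y|) \<psi>, where the
  comparison of norms is available; adding an orthogonal component would still produce f_k but could
  violate Bessel's inequality.\<close>

lemma has_sum_iterated_nonneg:
  fixes f :: "'a \<Rightarrow> 'b \<Rightarrow> real"
  assumes "\<And>a b. 0 \<le> f a b"
    and "\<And>a. ((\<lambda>b. f a b) has_sum g a) UNIV" and "(g has_sum s) UNIV"
  shows "((\<lambda>(a, b). f a b) has_sum s) UNIV"
proof -
  have "(\<lambda>(a, b). f a b) summable_on (UNIV \<times> UNIV)"
    by (rule summable_on_SigmaI[where g = g]) (use assms in \<open>auto simp: summable_on_def\<close>)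
  then have "((\<lambda>(a, b). f a b) has_sum s) (UNIV \<times> UNIV)"
    by (intro has_sum_SigmaI[where g = g]) (use assms in auto)
  then show ?thesis by simp
qed

text \<open>Tonelli in one direction, where nonnegativity upgrades iterated convergence to joint
  summability, and the general rule for iterated sums in the other.\<close>

lemma has_sum_prod_nonneg_iff:
  fixes f :: "'a \<Rightarrow> 'b \<Rightarrow> real"
  assumes "\<And>a b. 0 \<le> f a b" and "\<And>a. ((\<lambda>b. f a b) has_sum g a) UNIV"
  shows "((\<lambda>(a, b). f a b) has_sum s) UNIV \<longleftrightarrow> (g has_sum s) UNIV"
proof
  assume "((\<lambda>(a, b). f a b) has_sum s) UNIV"
  then have "((\<lambda>(a, b). f a b) has_sum s) (UNIV \<times> UNIV)" by simp
  then show "(g has_sum s) UNIV"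
    by (rule has_sum_SigmaD) (use assms in auto)
qed (use has_sum_iterated_nonneg assms in blast)

lemma has_sum_swap_UNIV:
  "((\<lambda>(a, b). f a b) has_sum s) UNIV \<longleftrightarrow> ((\<lambda>(b, a). f a b) has_sum s) UNIV"
  using has_sum_swap[where f = "\<lambda>(a, b). f a b" and A = UNIV and B = UNIV] by (simp add: case_prod_unfold)

text \<open>The sum over pairs is the common middle term. Being an equivalence, it transfers
  convergence too, so that a sum is shown to exist by summing in the other order.\<close>

lemma has_sum_swap_nonneg:
  fixes f :: "'a \<Rightarrow> 'b \<Rightarrow> real"
  assumes nn: "\<And>a b. 0 \<le> f a b"
    and a: "\<And>a. ((\<lambda>b. f a b) has_sum g a) UNIV" and b: "\<And>b. ((\<lambda>a. f a b) has_sum h b) UNIV"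
  shows "(g has_sum s) UNIV \<longleftrightarrow> (h has_sum s) UNIV"
proof -
  have "(g has_sum s) UNIV \<longleftrightarrow> ((\<lambda>(a, b). f a b) has_sum s) UNIV"
    by (rule has_sum_prod_nonneg_iff[symmetric]) (use nn a in auto)
  also have "\<dots> \<longleftrightarrow> ((\<lambda>(b, a). f a b) has_sum s) UNIV"
    by (rule has_sum_swap_UNIV)
  also have "\<dots> \<longleftrightarrow> (h has_sum s) UNIV"
    by (rule has_sum_prod_nonneg_iff) (use nn b in auto)
  finally show ?thesis .
qed

text \<open>Bridge between the ordered series of measurements and ensembles and the unordered sums
  of norms and traces.\<close>

lemma sums_nonneg_has_sum_iff:
  fixes f :: "nat \<Rightarrow> real"
  assumes "\<And>n. 0 \<le> f n"
  shows "f sums s \<longleftrightarrow> (f has_sum s) UNIV"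
  using assms has_sum_imp_sums sums_nonneg_imp_has_sum by blast

section \<open>Coordinates, inner product and norm\<close>

lemma ell2_eqI: "(\<And>i. coord x i = coord y i) \<Longrightarrow> x = y"
  by (metis coord_inject ext)

lemmas coord_simps [simp] = zero_ell2.rep_eq plus_ell2.rep_eq minus_ell2.rep_eq
  uminus_ell2.rep_eq scaleR_ell2.rep_eq scaleC.rep_eq ket.rep_eq bra_fst.rep_eq bra_snd.rep_eq

lemma coord_tensor [simp]: "coord (x \<otimes>\<^sub>v y) i = coord x (fst i) * coord y (snd i)"
  by (simp add: tensor.rep_eq case_prod_unfold)

lemma coord_assoc [simp]: "coord (assoc_ell2 x) ((a, b), c) = coord x (a, b, c)"
  by (simp add: assoc_ell2.rep_eq)

lemma scaleC_of_real: "of_real r *\<^sub>C x = r *\<^sub>R x"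
  by (rule ell2_eqI) (simp add: scaleR_conv_of_real)

lemma scaleC_simps [simp]:
  "a *\<^sub>C b *\<^sub>C x = (a * b) *\<^sub>C x" "1 *\<^sub>C x = x" "0 *\<^sub>C x = 0" "a *\<^sub>C (0 :: 'a ell2) = 0"
  by (rule ell2_eqI; simp)+

lemma scaleC_distrib:
  "a *\<^sub>C (x + y) = a *\<^sub>C x + a *\<^sub>C y" "a *\<^sub>C (x - y) = a *\<^sub>C x - a *\<^sub>C y"
  "(a + b) *\<^sub>C x = a *\<^sub>C x + b *\<^sub>C x" "(a - b) *\<^sub>C x = a *\<^sub>C x - b *\<^sub>C x"
  "r *\<^sub>R (a *\<^sub>C x) = a *\<^sub>C (r *\<^sub>R x)"
  by (rule ell2_eqI; simp add: algebra_simps)+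

lemma cinner_has_sum: "((\<lambda>i. cnj (coord x i) * coord y i) has_sum cinner x y) UNIV"
  unfolding cinner.rep_eq by (intro has_sum_infsum sq_summable_inner coord_sq_summable)

lemma cinner_commute: "cnj (cinner x y) = cinner y x"
  unfolding cinner.rep_eq infsum_cnj[symmetric] by (simp add: mult.commute)

lemma cinner_add_right: "cinner x (y + z) = cinner x y + cinner x z"
  using has_sum_add[OF cinner_has_sum[of x y] cinner_has_sum[of x z]] cinner_has_sum[of x "y + z"]
  by (auto simp: algebra_simps intro: has_sum_unique)

lemma cinner_scaleC_right [simp]: "cinner x (a *\<^sub>C y) = a * cinner x y"
  using has_sum_cmult_right[OF cinner_has_sum[of x y], of a] cinner_has_sum[of x "a *\<^sub>C y"]
  by (auto simp: algebra_simps intro: has_sum_unique)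

lemma cinner_scaleC_left [simp]: "cinner (a *\<^sub>C x) y = cnj a * cinner x y"
  by (metis cinner_commute cinner_scaleC_right complex_cnj_mult)

lemma cinner_add_left: "cinner (x + y) z = cinner x z + cinner y z"
  by (metis cinner_commute cinner_add_right complex_cnj_add)

lemma cinner_self_norm: "cinner x x = of_real ((norm x)\<^sup>2)"
  by (simp add: cinner_self norm_ell2_sq del: of_real_power)

lemma Re_cinner: "Re (cinner x y) = inner x y"
  by (simp add: inner_ell2_def)

lemma norm_scaleC [simp]: "norm (a *\<^sub>C x) = cmod a * norm x"
proof -
  have "of_real ((norm (a *\<^sub>C x))\<^sup>2) = cnj a * a * cinner x x"
    by (simp only: cinner_self_norm[symmetric] cinner_scaleC_left cinner_scaleC_right mult_ac)
  also have "\<dots> = of_real ((cmod a * norm x)\<^sup>2)"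
    by (simp add: cinner_self_norm power_mult_distrib complex_norm_square[symmetric] mult.commute[of "cnj a"])
  finally have "(norm (a *\<^sub>C x))\<^sup>2 = (cmod a * norm x)\<^sup>2"
    using of_real_eq_iff by blast
  then show ?thesis by (simp add: power2_eq_iff_nonneg)
qed

lemma norm_cinner_le: "cmod (cinner x y) \<le> norm x * norm y"
proof -
  \<comment> \<open>A phase that rotates the inner product onto its modulus reduces the claim to the
    real Cauchy-Schwarz inequality.\<close>
  obtain u where u: "cmod u = 1" "u * cinner x y = of_real (cmod (cinner x y))"
  proof (cases "cinner x y = 0")
    case False
    show ?thesis
    proof
      show "cmod (of_real (cmod (cinner x y)) / cinner x y) = 1"
        "of_real (cmod (cinner x y)) / cinner x y * cinner x y = of_real (cmod (cinner x y))"
        using False by (simp_all add: norm_divide)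
    qed
  qed (use that[of 1] in simp)
  have "cmod (cinner x y) = Re (cinner x (u *\<^sub>C y))"
    using u(2) by simp
  also have "\<dots> = inner x (u *\<^sub>C y)" by (rule Re_cinner)
  also have "\<dots> \<le> norm x * norm (u *\<^sub>C y)" by (rule norm_cauchy_schwarz)
  finally show ?thesis using u by simp
qed

interpretation cinner: bounded_bilinear "cinner :: 'a ell2 \<Rightarrow> 'a ell2 \<Rightarrow> complex"
proof
  fix x y :: "'a ell2" and r :: real
  show "cinner (r *\<^sub>R x) y = r *\<^sub>R cinner x y" "cinner x (r *\<^sub>R y) = r *\<^sub>R cinner x y"
    by (simp_all add: scaleC_of_real[symmetric] scaleR_conv_of_real)
  show "\<exists>K. \<forall>x y. cmod (cinner x y :: complex) \<le> norm (x :: 'a ell2) * norm y * K"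
    by (intro exI[of _ 1]) (simp add: norm_cinner_le)
qed (simp_all add: cinner_add_left cinner_add_right)

interpretation scaleC: bounded_bilinear "scaleC :: complex \<Rightarrow> 'a ell2 \<Rightarrow> 'a ell2"
proof
  fix x :: "'a ell2" and r :: real and a :: complex
  show "(r *\<^sub>R a) *\<^sub>C x = r *\<^sub>R (a *\<^sub>C x)" "a *\<^sub>C (r *\<^sub>R x) = r *\<^sub>R (a *\<^sub>C x)"
    by (rule ell2_eqI; simp)+
  show "\<exists>K. \<forall>a x. norm (a *\<^sub>C (x :: 'a ell2)) \<le> norm a * norm x * K"
    by (intro exI[of _ 1]) simp
qed (simp_all add: scaleC_distrib)

lemma cinner_ket_left [simp]: "cinner (ket i) x = coord x i"
proof -
  have "((\<lambda>j. cnj (coord (ket i) j) * coord x j) has_sum coord x i) UNIV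
      \<longleftrightarrow> ((\<lambda>j. coord x j) has_sum coord x i) {i}"
    by (rule has_sum_cong_neutral) auto
  then show ?thesis using has_sum_unique[OF cinner_has_sum] has_sum_finite[of "{i}" "coord x"] by force
qed

lemma cinner_ket_right [simp]: "cinner x (ket i) = cnj (coord x i)"
  by (metis cinner_commute cinner_ket_left)

lemma norm_ket [simp]: "norm (ket i) = 1"
proof -
  have "of_real ((norm (ket i))\<^sup>2) = (1 :: complex)"
    unfolding cinner_self_norm[symmetric] by simp
  then have "(norm (ket i))\<^sup>2 = 1" using of_real_eq_1_iff by blast
  then show ?thesis using norm_ge_zero[of "ket i"] by (auto simp: power2_eq_1_iff simp del: norm_ge_zero)
qed

lemma coord_sum: "coord (sum f F) i = (\<Sum>j\<in>F. coord (f j) i)"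
  by (simp add: cinner_ket_left[symmetric] cinner.sum_right del: cinner_ket_left)

lemma cinner_eqI: "(\<And>y. cinner y u = cinner y v) \<Longrightarrow> u = v"
  by (rule ell2_eqI) (metis cinner_ket_left)

lemma norm_sq_has_sum: "((\<lambda>i. (cmod (coord x i))\<^sup>2) has_sum (norm x)\<^sup>2) UNIV"
  unfolding norm_ell2_sq by (intro has_sum_infsum coord_sq_summable)

lemma ket_has_sum: "((\<lambda>i. coord x i *\<^sub>C ket i) has_sum x) UNIV"
proof -
  define S where "S F = (\<Sum>i\<in>F. coord x i *\<^sub>C ket i)" for F
  \<comment> \<open>Pythagoras: the squared error of a truncation is the tail of the sum of squared
    coordinates.\<close>
  have eq: "(norm (S F - x))\<^sup>2 = (norm x)\<^sup>2 - (\<Sum>i\<in>F. (cmod (coord x i))\<^sup>2)" if "finite F" for F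
  proof -
    have S: "coord (S F) i = (if i \<in> F then coord x i else 0)" for i
      using that by (simp add: S_def coord_sum if_distrib cong: if_cong)
    have *: "inner (S F) y = (\<Sum>i\<in>F. Re (cnj (coord x i) * coord y i))" for y
      by (simp add: Re_cinner[symmetric] S_def cinner.sum_left)
    have **: "Re (cnj z * z) = (cmod z)\<^sup>2" for z
      by (simp add: cmod_power2) (simp add: power2_eq_square)
    have "inner (S F) x = (\<Sum>i\<in>F. (cmod (coord x i))\<^sup>2)"
      unfolding * by (simp only: **)
    moreover have "inner (S F) (S F) = (\<Sum>i\<in>F. (cmod (coord x i))\<^sup>2)"
      unfolding * by (intro sum.cong refl) (simp only: S if_True **)
    ultimately show ?thesis
      by (simp add: power2_norm_eq_inner inner_diff_left inner_diff_right inner_commute)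
  qed
  have "((\<lambda>F. \<Sum>i\<in>F. (cmod (coord x i))\<^sup>2) \<longlongrightarrow> (norm x)\<^sup>2) (finite_subsets_at_top UNIV)"
    using norm_sq_has_sum[of x] by (simp add: has_sum_def)
  then have "((\<lambda>F. (norm x)\<^sup>2 - (\<Sum>i\<in>F. (cmod (coord x i))\<^sup>2)) \<longlongrightarrow> 0) (finite_subsets_at_top UNIV)"
    by (auto intro!: tendsto_eq_intros)
  then have "((\<lambda>F. (norm (S F - x))\<^sup>2) \<longlongrightarrow> 0) (finite_subsets_at_top UNIV)"
    by (rule Lim_transform_eventually) (auto simp: eventually_finite_subsets_at_top eq)
  then have "((\<lambda>F. sqrt ((norm (S F - x))\<^sup>2)) \<longlongrightarrow> sqrt 0) (finite_subsets_at_top UNIV)"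
    by (rule tendsto_real_sqrt)
  then have "(S \<longlongrightarrow> x) (finite_subsets_at_top UNIV)"
    by (simp add: tendsto_norm_zero_iff LIM_zero_iff)
  then show ?thesis by (simp add: has_sum_def S_def[abs_def])
qed

section \<open>Bounded complex-linear operators and strong convergence\<close>

lemma bounded_clinear_simps:
  assumes "bounded_clinear T"
  shows "T (x + y) = T x + T y" "T (x - y) = T x - T y" "T 0 = 0" "T (a *\<^sub>C x) = a *\<^sub>C T x"
    "T (r *\<^sub>R x) = r *\<^sub>R T x" "T (sum f F) = (\<Sum>i\<in>F. T (f i))"
proof -
  interpret bounded_linear T using assms by (simp add: bounded_clinear_def)
  show "T (x + y) = T x + T y" "T (x - y) = T x - T y" "T 0 = 0"
    "T (r *\<^sub>R x) = r *\<^sub>R T x" "T (sum f F) = (\<Sum>i\<in>F. T (f i))"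
    by (simp_all add: add diff zero scaleR sum)
  show "T (a *\<^sub>C x) = a *\<^sub>C T x" using assms by (simp add: bounded_clinear_def)
qed

lemma bounded_clinearI:
  assumes "\<And>x y. T (x + y) = T x + T y" "\<And>a x. T (a *\<^sub>C x) = a *\<^sub>C T x"
    "\<And>x. norm (T x) \<le> K * norm x"
  shows "bounded_clinear T"
  unfolding bounded_clinear_def
proof (intro conjI allI assms(2))
  show "bounded_linear T"
    by (rule bounded_linear_intro[where K = K])
      (use assms in \<open>auto simp: mult.commute scaleC_of_real[symmetric]\<close>)
qed

lemma bounded_clinear_bound:
  assumes "bounded_clinear T"
  obtains K where "0 \<le> K" "\<And>x. norm (T x) \<le> K * norm x"
  using assms bounded_linear.nonneg_bounded[of T] unfolding bounded_clinear_def
  by (metis mult.commute)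

lemma bounded_clinear_has_sum_ket:
  assumes "bounded_clinear T"
  shows "((\<lambda>i. coord x i *\<^sub>C T (ket i)) has_sum T x) UNIV"
  using has_sum_bounded_linear[of T, OF _ ket_has_sum[of x]] assms
  by (simp add: bounded_clinear_def)

lemma bounded_clinear_eqI:
  assumes "bounded_clinear S" "bounded_clinear T" "\<And>i. S (ket i) = T (ket i)"
  shows "S x = T x"
  using bounded_clinear_has_sum_ket[OF assms(1)] bounded_clinear_has_sum_ket[OF assms(2)]
  by (metis (no_types, lifting) assms(3) has_sum_cong has_sum_unique)

text \<open>A uniform bound extends convergence from finite combinations of kets to their limits.
  The set \<open>I\<close> restricts the test to kets in the support of \<open>x\<close>; this is
  what later makes a countable enumeration sufficient.\<close>

lemma tendsto_zero_if_ket: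
  assumes T: "\<And>n. bounded_clinear (T n)" and K: "\<And>n x. norm (T n x) \<le> K * norm x"
    and I: "\<And>i. i \<in> I \<Longrightarrow> (\<lambda>n. T n (ket i)) \<longlonglongrightarrow> 0" and x: "\<And>i. i \<notin> I \<Longrightarrow> coord x i = 0"
  shows "(\<lambda>n. T n x) \<longlonglongrightarrow> 0"
proof (rule LIMSEQ_I)
  fix e :: real assume "0 < e"
  have K0: "0 \<le> K" using order_trans[OF norm_ge_zero K[of 0 "ket undefined"]] by simp
  \<comment> \<open>\<open>K + 1\<close> instead of \<open>K\<close> keeps the denominator positive
    when \<open>K = 0\<close>.\<close>
  define d where "d = e / 2 / (K + 1)"
  have d: "0 < d" using \<open>0 < e\<close> K0 by (simp add: d_def)
  have "\<forall>\<^sub>F F in finite_subsets_at_top UNIV. dist (\<Sum>i\<in>F. coord x i *\<^sub>C ket i) x < d"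
    using tendstoD[OF ket_has_sum[of x, unfolded has_sum_def] d] .
  then obtain F where F: "finite F" "dist (\<Sum>i\<in>F. coord x i *\<^sub>C ket i) x < d"
    unfolding eventually_finite_subsets_at_top by auto
  define s where "s = (\<Sum>i\<in>F. coord x i *\<^sub>C ket i)"
  have "(\<lambda>n. \<Sum>i\<in>F. coord x i *\<^sub>C T n (ket i)) \<longlonglongrightarrow> (\<Sum>i\<in>F. 0)"
  proof (rule tendsto_sum)
    fix i
    show "(\<lambda>n. coord x i *\<^sub>C T n (ket i)) \<longlonglongrightarrow> 0"
    proof (cases "i \<in> I")
      case True
      then show ?thesis using scaleC.tendsto[OF tendsto_const I[OF True], of "coord x i"] by simp
    qed (simp add: x)
  qed
  then have "(\<lambda>n. T n s) \<longlonglongrightarrow> 0"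
    by (simp add: s_def bounded_clinear_simps[OF T])
  then obtain N where N: "\<And>n. n \<ge> N \<Longrightarrow> norm (T n s) < e / 2"
    using LIMSEQ_D[of "\<lambda>n. T n s" 0 "e / 2"] \<open>0 < e\<close> by auto
  have "norm (T n x - 0) < e" if "n \<ge> N" for n
  proof -
    have "norm (T n x) \<le> norm (T n s) + norm (T n (x - s))"
      using norm_triangle_ineq[of "T n s" "T n (x - s)"]
      by (simp add: bounded_clinear_simps(2)[OF T])
    also have "norm (T n (x - s)) \<le> K * d"
      using K[of n "x - s"] F(2) K0 mult_left_mono[of "norm (x - s)" d K]
      unfolding s_def by (simp add: dist_norm norm_minus_commute)
    also have "K * d \<le> e / 2"
    proof -
      have "K * d \<le> (K + 1) * d" using d by simp
      moreover have "K + 1 \<noteq> 0" using K0 by simp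
      then have "(K + 1) * d = e / 2"
        unfolding d_def by (subst times_divide_eq_right) (rule nonzero_mult_div_cancel_left)
      ultimately show ?thesis by simp
    qed
    finally show ?thesis using N[OF that] by simp
  qed
  then show "\<exists>no. \<forall>n\<ge>no. norm (T n x - 0) < e" by blast
qed

section \<open>Positive operators\<close>

lemma positive_op_bounded: "positive_op M \<Longrightarrow> bounded_clinear M"
  by (simp add: positive_op_def)

lemmas positive_op_simps = bounded_clinear_simps[OF positive_op_bounded]

lemma positive_op_cinner:
  assumes "positive_op M"
  shows "0 \<le> Re (cinner x (M x))" "cinner x (M x) = of_real (Re (cinner x (M x)))"
proof -
  have *: "cinner x (M x) \<in> \<real>\<^sub>\<ge>\<^sub>0" using assms by (simp add: positive_op_def)
  then show "0 \<le> Re (cinner x (M x))" "cinner x (M x) = of_real (Re (cinner x (M x)))"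
    by (auto simp: complex_nonneg_Reals_iff complex_eq_iff)
qed

lemma positive_opI:
  assumes "bounded_clinear M" "\<And>x. cinner x (M x) = of_real (q x)" "\<And>x. 0 \<le> q x"
  shows "positive_op M"
  using assms by (simp add: positive_op_def)

lemma positive_op_hermitian:
  assumes M: "positive_op M"
  shows "cinner (M x) y = cinner x (M y)"
proof -
  \<comment> \<open>Polarization: reality of the form at \<open>x + y\<close> yields the imaginary
    part of the symmetry, and at \<open>x + \<i> *\<^sub>C y\<close> the real part.\<close>
  have 0: "Im (cinner z (M z)) = 0" for z
    using positive_op_cinner(2)[OF M, of z] by (metis Im_complex_of_real)
  have 1: "Im (cinner x (M y)) + Im (cinner y (M x)) = 0"
    using 0[of "x + y"] 0[of x] 0[of y]
    by (simp add: positive_op_simps[OF M] cinner_add_left cinner_add_right)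
  have 2: "Re (cinner x (M y)) - Re (cinner y (M x)) = 0"
    using 0[of "x + \<i> *\<^sub>C y"] 0[of x] 0[of y]
    by (simp add: positive_op_simps[OF M] cinner_add_left cinner_add_right)
  have "cinner x (M y) = cnj (cinner y (M x))"
    using 1 2 by (simp add: complex_eq_iff)
  then show ?thesis by (simp add: cinner_commute)
qed

lemma positive_op_Cauchy_Schwarz:
  assumes M: "positive_op M"
  shows "(cmod (cinner y (M x)))\<^sup>2 \<le> Re (cinner y (M y)) * Re (cinner x (M x))"
proof -
  define z A D where "z = cinner y (M x)" "A = Re (cinner x (M x))" "D = Re (cinner y (M y))"
  note defs = this
  have xy: "cinner x (M y) = cnj z"
    by (simp add: defs cinner_commute positive_op_hermitian[OF M])
  \<comment> \<open>The form is evaluated at x + s z y. The factor \<open>z\<close> supplies the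
    phase that makes the cross terms real, so that a real quadratic polynomial in \<open>s\<close>
    remains.\<close>
  have *: "0 \<le> A + 2 * s * (cmod z)\<^sup>2 + s\<^sup>2 * (cmod z)\<^sup>2 * D" for s
  proof -
    have "0 \<le> Re (cinner (x + (of_real s * z) *\<^sub>C y) (M (x + (of_real s * z) *\<^sub>C y)))"
      by (rule positive_op_cinner[OF M])
    also have "\<dots> = Re (cinner x (M x)) + Re (of_real s * z * cinner x (M y))
        + Re (cnj (of_real s * z) * cinner y (M x))
        + Re (cnj (of_real s * z) * (of_real s * z) * cinner y (M y))"
      by (simp add: positive_op_simps[OF M] cinner_add_left cinner_add_right algebra_simps)
    also have "\<dots> = A + 2 * s * (cmod z)\<^sup>2 + s\<^sup>2 * (cmod z)\<^sup>2 * D"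
    proof -
      have "of_real s * z * cinner x (M y) = of_real (s * (cmod z)\<^sup>2)"
        "cnj (of_real s * z) * cinner y (M x) = of_real (s * (cmod z)\<^sup>2)"
        by (simp_all add: xy complex_norm_square mult_ac flip: defs(1) del: of_real_power)
      moreover have "cnj (of_real s * z) * (of_real s * z) * cinner y (M y) = of_real (s\<^sup>2 * (cmod z)\<^sup>2 * D)"
        by (subst positive_op_cinner(2)[OF M]) (simp add: complex_norm_square power2_eq_square[of s] mult_ac flip: defs del: of_real_power)
      ultimately show ?thesis by (simp only: Re_complex_of_real) (simp add: defs)
    qed
    finally show ?thesis .
  qed
  have D: "0 \<le> D" unfolding defs by (rule positive_op_cinner[OF M])
  show ?thesis
  proof (cases "D = 0")
    case True
    have "(cmod z)\<^sup>2 \<le> 0"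
    proof (rule ccontr)
      assume "\<not> (cmod z)\<^sup>2 \<le> 0"
      then have "0 < (cmod z)\<^sup>2" by simp
      \<comment> \<open>For \<open>D = 0\<close> the polynomial is linear in \<open>s\<close>, and
        this \<open>s\<close> gives it the value -1.\<close>
      then show False using *[of "- (A + 1) / (2 * (cmod z)\<^sup>2)"] True by (simp add: field_simps)
    qed
    then show ?thesis using True by (simp add: defs)
  next
    case False
    then have "0 < D" using D by simp
    \<comment> \<open>The minimizer of the quadratic polynomial.\<close>
    then show ?thesis using *[of "- 1 / D"]
      by (simp add: defs[symmetric] field_simps power2_eq_square)
  qed
qed

text \<open>This is M^2 \<le> K M as forms, obtained from Cauchy-Schwarz with the test vector
  \<open>M x\<close>. It converts smallness of the form at \<open>x\<close> into smallness of the
  vector \<open>M x\<close>.\<close>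

lemma positive_op_form_bound:
  assumes M: "positive_op M" and K: "\<And>x. Re (cinner x (M x)) \<le> K * (norm x)\<^sup>2"
  shows "(norm (M x))\<^sup>2 \<le> K * Re (cinner x (M x))"
proof -
  define w q where "w = M x" "q = Re (cinner x (M x))"
  have "(cmod (cinner w (M x)))\<^sup>2 \<le> Re (cinner w (M w)) * q"
    unfolding w_q_def by (rule positive_op_Cauchy_Schwarz[OF M])
  also have "\<dots> \<le> (K * (norm w)\<^sup>2) * q"
    by (rule mult_right_mono[OF K]) (simp add: w_q_def positive_op_cinner(1)[OF M])
  finally have "((norm w)\<^sup>2)\<^sup>2 \<le> (norm w)\<^sup>2 * (K * q)"
    by (simp add: w_q_def cinner_self_norm norm_power mult_ac)
  then have "(norm w)\<^sup>2 \<le> K * q" if "w \<noteq> 0"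
    using that by (simp add: power2_eq_square)
  moreover have "0 \<le> K * q"
  proof -
    have "0 \<le> K"
      using order_trans[OF positive_op_cinner(1)[OF M] K[of "ket undefined"]] by simp
    then show ?thesis using positive_op_cinner(1)[OF M] by (simp add: w_q_def)
  qed
  ultimately show ?thesis unfolding w_q_def by fastforce
qed

text \<open>Serves to bound all Cholesky remainders by one constant, since they are dominated by
  \<open>M\<close> only in the sense of forms.\<close>

lemma positive_op_norm_bound:
  assumes M: "positive_op M" and K: "\<And>x. Re (cinner x (M x)) \<le> K * (norm x)\<^sup>2"
  shows "norm (M x) \<le> K * norm x"
proof -
  have K0: "0 \<le> K"
    using order_trans[OF positive_op_cinner(1)[OF M] K[of "ket undefined"]] by simp
  have "(norm (M x))\<^sup>2 \<le> K * Re (cinner x (M x))"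
    using assms by (rule positive_op_form_bound)
  also have "\<dots> \<le> K * (K * (norm x)\<^sup>2)"
    using K K0 by (rule mult_left_mono)
  also have "\<dots> = (K * norm x)\<^sup>2" by (simp add: power2_eq_square)
  finally show ?thesis by (rule power2_le_imp_le) (simp add: K0)
qed

lemma positive_op_bound:
  assumes M: "positive_op M"
  obtains K where "0 \<le> K" "\<And>x. Re (cinner x (M x)) \<le> K * (norm x)\<^sup>2"
proof -
  obtain K where K: "0 \<le> K" "\<And>x. norm (M x) \<le> K * norm x"
    using bounded_clinear_bound[OF positive_op_bounded[OF M]] by metis
  have "Re (cinner x (M x)) \<le> K * (norm x)\<^sup>2" for x
  proof -
    have "Re (cinner x (M x)) \<le> norm x * norm (M x)"
      using complex_Re_le_cmod norm_cinner_le order_trans by blast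
    also have "\<dots> \<le> norm x * (K * norm x)" using K by (intro mult_left_mono) auto
    finally show ?thesis by (simp add: power2_eq_square mult_ac)
  qed
  then show ?thesis using that K by blast
qed

lemma cinner_proj: "cinner x (proj v x) = of_real ((cmod (cinner v x))\<^sup>2)"
proof -
  have "cinner x (proj v x) = cinner v x * cnj (cinner v x)"
    by (simp add: proj_def cinner_commute)
  then show ?thesis by (simp only: complex_norm_square)
qed

lemma norm_proj_le: "norm (proj w x) \<le> (norm w)\<^sup>2 * norm x"
  using mult_right_mono[OF norm_cinner_le[of w x], of "norm w"]
  by (simp add: proj_def power2_eq_square mult_ac)

lemma bounded_clinear_proj: "bounded_clinear (proj v)"
  by (rule bounded_clinearI[OF _ _ norm_proj_le])
    (simp_all add: proj_def cinner_add_right scaleC_distrib)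

lemma positive_op_proj: "positive_op (proj v)"
  by (rule positive_opI[OF bounded_clinear_proj cinner_proj]) simp

lemma bounded_clinear_diff:
  assumes "bounded_clinear S" "bounded_clinear T"
  shows "bounded_clinear (\<lambda>x. S x - T x)"
  using assms bounded_linear_sub[of S T]
  by (auto simp: bounded_clinear_def scaleC_distrib)

lemma bounded_clinear_sum:
  assumes "\<And>i. i \<in> F \<Longrightarrow> bounded_clinear (T i)"
  shows "bounded_clinear (\<lambda>x. \<Sum>i\<in>F. T i x)"
  using assms bounded_linear_sum[of F T]
  by (auto simp: bounded_clinear_def scaleC.sum_right)

lemma bounded_clinear_comp:
  assumes "bounded_clinear S" "bounded_clinear T"
  shows "bounded_clinear (\<lambda>x. S (T x))"
  using assms bounded_linear_compose[of S T] by (auto simp: bounded_clinear_def)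

text \<open>Cholesky factorization: subtracting from \<open>M\<close> the rank-one operator
  of \<open>M e / sqrt \<langle>e|M|e\<rangle>\<close> (zero if \<open>\<langle>e|M|e\<rangle> = 0\<close>, as \<open>x / 0 = 0\<close>) leaves a positive operator
  that annihilates \<open>e\<close> and the kernel of \<open>M\<close>.\<close>

definition chol :: "('a ell2 \<Rightarrow> 'a ell2) \<Rightarrow> 'a ell2 \<Rightarrow> 'a ell2" where
  "chol M e = (1 / sqrt (Re (cinner e (M e)))) *\<^sub>R M e"

lemma chol_proj:
  assumes M: "positive_op M"
  shows "proj (chol M e) x = (cinner e (M x) / of_real (Re (cinner e (M e)))) *\<^sub>C M e"
proof -
  define q where "q = Re (cinner e (M e))"
  have "0 \<le> q" using positive_op_cinner[OF M] by (simp add: q_def)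
  then have "sqrt q * sqrt q = q" by simp
  then have s: "complex_of_real (sqrt q) * of_real (sqrt q) = of_real q"
    by (metis of_real_mult)
  have "proj (chol M e) x = (cinner (M e) x / of_real (sqrt q) / of_real (sqrt q)) *\<^sub>C M e"
    by (simp add: proj_def chol_def q_def flip: scaleC_of_real)
  also have "cinner (M e) x / of_real (sqrt q) / of_real (sqrt q) = cinner e (M x) / of_real q"
    by (simp add: positive_op_hermitian[OF M] flip: s)
  finally show ?thesis by (simp add: q_def)
qed

lemma positive_op_zeroD:
  assumes M: "positive_op M" and "Re (cinner e (M e)) = 0"
  shows "M e = 0"
proof -
  have "(cmod (cinner (M e) (M e)))\<^sup>2 \<le> 0"
    using positive_op_Cauchy_Schwarz[OF M, of "M e" e] assms(2) by simp
  then show ?thesis by (simp add: cinner_self_norm)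
qed

text \<open>Positivity is the Cauchy-Schwarz inequality for the form of \<open>M\<close>, since the
  subtracted form is |<e|M x>|^2 / <e|M e>. If <e|M e> = 0, then \<open>M e\<close> already vanishes
  and nothing is subtracted.\<close>

lemma chol_step:
  fixes M :: "'a ell2 \<Rightarrow> 'a ell2" and e :: "'a ell2"
  assumes M: "positive_op M"
  defines "R \<equiv> \<lambda>x. M x - proj (chol M e) x"
  shows "positive_op R" "R e = 0" "M x = 0 \<Longrightarrow> R x = 0"
proof -
  define q where "q = Re (cinner e (M e))"
  have q: "0 \<le> q" using positive_op_cinner[OF M] by (simp add: q_def)
  show "positive_op R"
  proof (rule positive_opI)
    show "bounded_clinear R"
      unfolding R_def by (intro bounded_clinear_diff bounded_clinear_proj positive_op_bounded M)
    show "cinner x (R x) = of_real (Re (cinner x (M x)) - (cmod (cinner (chol M e) x))\<^sup>2)" for x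
      unfolding R_def cinner.diff_right cinner_proj using positive_op_cinner(2)[OF M, of x] by simp
    have "(cmod (cinner (chol M e) x))\<^sup>2 = (cmod (cinner e (M x)))\<^sup>2 / q" for x
    proof -
      have "cinner (chol M e) x = cinner e (M x) / of_real (sqrt q)"
        by (simp add: chol_def q_def positive_op_hermitian[OF M] flip: scaleC_of_real)
      then show ?thesis using q by (simp add: norm_divide power_divide)
    qed
    moreover have "(cmod (cinner e (M x)))\<^sup>2 / q \<le> Re (cinner x (M x))" for x
      using positive_op_Cauchy_Schwarz[OF M, of e x] q positive_op_cinner(1)[OF M, of x]
      by (cases "q = 0") (simp_all add: field_simps flip: q_def)
    ultimately show "0 \<le> Re (cinner x (M x)) - (cmod (cinner (chol M e) x))\<^sup>2" for x by simp
  qed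
  show "R e = 0"
  proof (cases "q = 0")
    case True
    then show ?thesis using positive_op_zeroD[OF M, of e]
      by (simp add: R_def chol_proj[OF M] q_def)
  next
    case False
    have "cinner e (M e) = of_real q" unfolding q_def by (rule positive_op_cinner(2)[OF M])
    then show ?thesis using False by (simp add: R_def chol_proj[OF M])
  qed
  show "R x = 0" if "M x = 0"
    using that by (simp add: R_def chol_proj[OF M] cinner.zero_right)
qed

fun chol_rest :: "('a ell2 \<Rightarrow> 'a ell2) \<Rightarrow> (nat \<Rightarrow> 'a ell2) \<Rightarrow> nat \<Rightarrow> 'a ell2 \<Rightarrow> 'a ell2" where
  "chol_rest M e 0 = M"
| "chol_rest M e (Suc n) = (\<lambda>x. chol_rest M e n x - proj (chol (chol_rest M e n) (e n)) x)"

definition chol_vec :: "('a ell2 \<Rightarrow> 'a ell2) \<Rightarrow> (nat \<Rightarrow> 'a ell2) \<Rightarrow> nat \<Rightarrow> 'a ell2" where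
  "chol_vec M e n = chol (chol_rest M e n) (e n)"

lemma positive_op_chol_rest:
  assumes "positive_op M"
  shows "positive_op (chol_rest M e n)"
  by (induction n) (simp_all add: assms chol_step(1))

text \<open>The step from \<open>k\<close> to \<open>Suc k\<close> annihilates \<open>e k\<close>,
  and later steps preserve the kernel. Hence the strict inequality: \<open>chol_rest M e k\<close>
  itself need not vanish at \<open>e k\<close>.\<close>

lemma chol_rest_kernel:
  assumes "positive_op M" "k < n"
  shows "chol_rest M e n (e k) = 0"
  using assms(2)
proof (induction n)
  case (Suc n)
  note step = chol_step[OF positive_op_chol_rest[OF assms(1)]]
  show ?case
  proof (cases "k = n")
    case True
    then show ?thesis using step(2) by simp
  next
    case False
    then show ?thesis using step(3) Suc by simp
  qed
qed simp

lemma chol_decomp: "M x = (\<Sum>j<n. proj (chol_vec M e j) x) + chol_rest M e n x"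
  by (induction n) (simp_all add: chol_vec_def)

lemma chol_form:
  assumes "positive_op M"
  shows "Re (cinner x (M x)) = (\<Sum>j<n. (cmod (cinner (chol_vec M e j) x))\<^sup>2) + Re (cinner x (chol_rest M e n x))"
  by (subst chol_decomp[of M x e n]) (simp add: cinner_add_right cinner.sum_right cinner_proj)

lemma chol_rest_bound:
  assumes "positive_op M"
  shows "Re (cinner x (chol_rest M e n x)) \<le> Re (cinner x (M x))"
  using chol_form[OF assms, of x e n] by (simp add: sum_nonneg)

lemma chol_partial_bound:
  assumes "positive_op M"
  shows "(\<Sum>j<n. (cmod (cinner (chol_vec M e j) x))\<^sup>2) \<le> Re (cinner x (M x))"
  using chol_form[OF assms, of x e n] positive_op_cinner(1)[OF positive_op_chol_rest[OF assms], of x e n]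
  by simp

text \<open>The remainders are uniformly bounded, and at each enumerated ket they are eventually
  exactly zero.\<close>

lemma chol_rest_tendsto:
  assumes M: "positive_op M" and e: "ket ` I \<subseteq> range e" and x: "\<And>i. i \<notin> I \<Longrightarrow> coord x i = 0"
  shows "(\<lambda>n. chol_rest M e n x) \<longlonglongrightarrow> 0"
proof -
  obtain K where K: "0 \<le> K" "\<And>x. Re (cinner x (M x)) \<le> K * (norm x)\<^sup>2"
    using positive_op_bound[OF M] by metis
  show ?thesis
  proof (rule tendsto_zero_if_ket[where I = I and K = K])
    show "bounded_clinear (chol_rest M e n)" for n
      by (intro positive_op_bounded positive_op_chol_rest M)
    show "norm (chol_rest M e n x) \<le> K * norm x" for n x
      by (rule positive_op_norm_bound[OF positive_op_chol_rest[OF M]])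
        (use chol_rest_bound[OF M] K order_trans in blast)
    show "(\<lambda>n. chol_rest M e n (ket i)) \<longlonglongrightarrow> 0" if "i \<in> I" for i
    proof -
      obtain k where "ket i = e k" using e \<open>i \<in> I\<close> by auto
      then have "chol_rest M e n (ket i) = 0" if "n > k" for n
        using chol_rest_kernel[OF M that] by simp
      then show ?thesis
        by (intro tendsto_eventually eventually_mono[OF eventually_gt_at_top[of k]])
    qed
  qed (rule x)
qed

text \<open>Parseval's identity for the Cholesky vectors. It is restricted to vectors supported in
  \<open>I\<close>, because the sequence \<open>e\<close> need not reach all of an uncountable
  basis.\<close>

lemma chol_form_sums:
  assumes M: "positive_op M" and e: "ket ` I \<subseteq> range e" and x: "\<And>i. i \<notin> I \<Longrightarrow> coord x i = 0"
  shows "(\<lambda>j. (cmod (cinner (chol_vec M e j) x))\<^sup>2) sums Re (cinner x (M x))"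
proof -
  have "(\<lambda>n. Re (cinner x (M x)) - Re (cinner x (chol_rest M e n x))) \<longlonglongrightarrow> Re (cinner x (M x)) - Re (cinner x 0)"
    by (intro tendsto_intros cinner.tendsto chol_rest_tendsto[OF M e x])
  moreover have "(\<Sum>j<n. (cmod (cinner (chol_vec M e j) x))\<^sup>2)
      = Re (cinner x (M x)) - Re (cinner x (chol_rest M e n x))" for n
    using chol_form[OF M, of x e n] by simp
  ultimately show ?thesis
    by (simp add: sums_def cinner.zero_right)
qed

text \<open>The tail \<open>T n\<close> is positive and lies below \<open>R\<close> as a form, so
  the norm of \<open>T n y\<close> is controlled by a form value that tends to zero. A decomposition
  thus has to be verified on quadratic forms only.\<close>

lemma positive_op_sums_proj:
  assumes R: "positive_op R"
    and q: "\<And>y. (\<lambda>k. (cmod (cinner (f k) y))\<^sup>2) sums Re (cinner y (R y))"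
  shows "(\<lambda>k. proj (f k) y) sums R y"
proof -
  obtain K where K: "0 \<le> K" "\<And>x. Re (cinner x (R x)) \<le> K * (norm x)\<^sup>2"
    using positive_op_bound[OF R] by metis
  define T where "T n x = R x - (\<Sum>k<n. proj (f k) x)" for n x
  have cT: "cinner x (T n x) = of_real (Re (cinner x (R x)) - (\<Sum>k<n. (cmod (cinner (f k) x))\<^sup>2))" for n x
    unfolding T_def cinner.diff_right cinner.sum_right cinner_proj
    using positive_op_cinner(2)[OF R, of x] by simp
  have le: "(\<Sum>k<n. (cmod (cinner (f k) x))\<^sup>2) \<le> Re (cinner x (R x))" for n x
    using q[of x] by (metis sum_le_suminf sums_iff finite_lessThan zero_le_power2)
  have T: "positive_op (T n)" for n
  proof (rule positive_opI[OF _ cT])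
    show "bounded_clinear (T n)"
      unfolding T_def by (intro bounded_clinear_diff bounded_clinear_sum bounded_clinear_proj positive_op_bounded R)
  qed (simp add: le)
  have "Re (cinner x (T n x)) \<le> Re (cinner x (R x))" for n x
    unfolding cT by (simp add: sum_nonneg)
  then have *: "(norm (T n y))\<^sup>2 \<le> K * Re (cinner y (T n y))" for n
    by (intro positive_op_form_bound[OF T]) (use K order_trans in blast)
  have "(\<lambda>n. K * (Re (cinner y (R y)) - (\<Sum>k<n. (cmod (cinner (f k) y))\<^sup>2))) \<longlonglongrightarrow> K * (Re (cinner y (R y)) - Re (cinner y (R y)))"
    using q[of y] unfolding sums_def by (intro tendsto_intros)
  then have lim: "(\<lambda>n. K * Re (cinner y (T n y))) \<longlonglongrightarrow> 0" unfolding cT by simp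
  have "(\<lambda>n. (norm (T n y))\<^sup>2) \<longlonglongrightarrow> 0"
    by (rule tendsto_sandwich[OF _ _ tendsto_const lim]) (use * in auto)
  then have "(\<lambda>n. sqrt ((norm (T n y))\<^sup>2)) \<longlonglongrightarrow> sqrt 0" by (rule tendsto_real_sqrt)
  then have "(\<lambda>n. T n y) \<longlonglongrightarrow> 0" by (simp add: tendsto_norm_zero_iff)
  then have "(\<lambda>n. R y - T n y) \<longlonglongrightarrow> R y - 0" by (intro tendsto_intros)
  then show ?thesis by (simp add: sums_def T_def)
qed

section \<open>Tensor products\<close>

declare cinner.zero_right [simp] cinner.zero_left [simp]

lemma slice_simps [simp]:
  "bra_fst a (x + y) = bra_fst a x + bra_fst a y" "bra_fst a (c *\<^sub>C x) = c *\<^sub>C bra_fst a x"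
  "bra_snd b (x + y) = bra_snd b x + bra_snd b y" "bra_snd b (c *\<^sub>C x) = c *\<^sub>C bra_snd b x"
  "bra_fst a (u \<otimes>\<^sub>v v) = coord u a *\<^sub>C v" "bra_snd b (u \<otimes>\<^sub>v v) = coord v b *\<^sub>C u"
  by (rule ell2_eqI; simp)+

lemma ket_tensor: "ket a \<otimes>\<^sub>v ket b = ket (a, b)"
  by (rule ell2_eqI) (auto simp: prod_eq_iff)

lemma norm_bra_fst_has_sum: "((\<lambda>a. (norm (bra_fst a x))\<^sup>2) has_sum (norm x)\<^sup>2) UNIV"
proof -
  have "((\<lambda>(a, b). (cmod (coord x (a, b)))\<^sup>2) has_sum (norm x)\<^sup>2) UNIV"
    using norm_sq_has_sum[of x] by (simp add: case_prod_unfold)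
  moreover have "((\<lambda>b. (cmod (coord x (a, b)))\<^sup>2) has_sum (norm (bra_fst a x))\<^sup>2) UNIV" for a
    using norm_sq_has_sum[of "bra_fst a x"] by simp
  ultimately show ?thesis
    using has_sum_prod_nonneg_iff[of "\<lambda>a b. (cmod (coord x (a, b)))\<^sup>2"] by fastforce
qed

lemma norm_bra_snd_has_sum: "((\<lambda>b. (norm (bra_snd b x))\<^sup>2) has_sum (norm x)\<^sup>2) UNIV"
proof -
  have "((\<lambda>a. (norm (bra_fst a x))\<^sup>2) has_sum (norm x)\<^sup>2) UNIV
      \<longleftrightarrow> ((\<lambda>b. (norm (bra_snd b x))\<^sup>2) has_sum (norm x)\<^sup>2) UNIV"
  proof (rule has_sum_swap_nonneg)
    show "((\<lambda>b. (cmod (coord x (a, b)))\<^sup>2) has_sum (norm (bra_fst a x))\<^sup>2) UNIV" for a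
      using norm_sq_has_sum[of "bra_fst a x"] by simp
    show "((\<lambda>a. (cmod (coord x (a, b)))\<^sup>2) has_sum (norm (bra_snd b x))\<^sup>2) UNIV" for b
      using norm_sq_has_sum[of "bra_snd b x"] by simp
  qed simp
  then show ?thesis using norm_bra_fst_has_sum by blast
qed

lemma coord_Abs_ell2:
  assumes "(\<lambda>i. (cmod (f i))\<^sup>2) summable_on UNIV"
  shows "coord (Abs_ell2 f) = f"
  using assms by (simp add: Abs_ell2_inverse)

lemma norm_le_if_has_sum:
  assumes s: "((\<lambda>i. (g i)\<^sup>2) has_sum s\<^sup>2) UNIV" and "0 \<le> K" "0 \<le> s"
    and "\<And>i. cmod (coord x i) \<le> K * g i"
  shows "norm x \<le> K * s"
proof (rule power2_le_imp_le)
  have "((\<lambda>i. K\<^sup>2 * (g i)\<^sup>2) has_sum K\<^sup>2 * s\<^sup>2) UNIV"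
    by (rule has_sum_cmult_right[OF s])
  moreover have "(cmod (coord x i))\<^sup>2 \<le> K\<^sup>2 * (g i)\<^sup>2" for i
    using power_mono[OF assms(4)[of i], of 2] by (simp add: power_mult_distrib)
  ultimately show "(norm x)\<^sup>2 \<le> (K * s)\<^sup>2"
    using has_sum_mono[OF norm_sq_has_sum] by (auto simp: power_mult_distrib)
qed (use assms in simp)

lemma sq_summable_if_has_sum:
  assumes s: "((\<lambda>i. (g i)\<^sup>2) has_sum s) UNIV" and le: "\<And>i. cmod (f i) \<le> K * g i"
  shows "(\<lambda>i. (cmod (f i))\<^sup>2) summable_on UNIV"
proof (rule summable_on_comparison_test)
  show "(\<lambda>i. K\<^sup>2 * (g i)\<^sup>2) summable_on UNIV"
    using has_sum_cmult_right[OF s] by (rule has_sum_imp_summable)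
  show "(cmod (f i))\<^sup>2 \<le> K\<^sup>2 * (g i)\<^sup>2" for i
    using power_mono[OF le[of i], of 2] by (simp add: power_mult_distrib)
qed simp

text \<open>\<open>left_bra m\<close> is \<open>\<langle>m| \<otimes> 1\<close>, and \<open>right_bra y\<close> is \<open>1 \<otimes> \<langle>y|\<close>.\<close>

definition left_bra :: "'a ell2 \<Rightarrow> ('a \<times> 'b) ell2 \<Rightarrow> 'b ell2" where
  "left_bra m x = Abs_ell2 (\<lambda>b. cinner m (bra_snd b x))"

definition right_bra :: "'b ell2 \<Rightarrow> ('a \<times> 'b) ell2 \<Rightarrow> 'a ell2" where
  "right_bra y x = Abs_ell2 (\<lambda>a. cinner y (bra_fst a x))"

lemma coord_left_bra [simp]: "coord (left_bra m x) b = cinner m (bra_snd b x)"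
  unfolding left_bra_def
  by (subst coord_Abs_ell2) (auto intro: sq_summable_if_has_sum norm_bra_snd_has_sum norm_cinner_le)

lemma coord_right_bra [simp]: "coord (right_bra y x) a = cinner y (bra_fst a x)"
  unfolding right_bra_def
  by (subst coord_Abs_ell2) (auto intro: sq_summable_if_has_sum norm_bra_fst_has_sum norm_cinner_le)

lemma norm_left_bra_le: "norm (left_bra m x) \<le> norm m * norm x"
  by (rule norm_le_if_has_sum[OF norm_bra_snd_has_sum]) (simp_all add: norm_cinner_le)

lemma norm_left_bra_has_sum:
  "((\<lambda>b. (cmod (cinner m (bra_snd b x)))\<^sup>2) has_sum (norm (left_bra m x))\<^sup>2) UNIV"
  using norm_sq_has_sum[of "left_bra m x"] by simp

lemma bounded_clinear_left_bra: "bounded_clinear (left_bra m)"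
  by (rule bounded_clinearI[OF _ _ norm_left_bra_le]; rule ell2_eqI; simp add: cinner_add_right)

lemma right_bra_add: "right_bra (y + z) x = right_bra y x + right_bra z x"
  by (rule ell2_eqI) (simp add: cinner_add_left)

lemma right_bra_scaleC: "right_bra (c *\<^sub>C y) x = cnj c *\<^sub>C right_bra y x"
  by (rule ell2_eqI) simp

lemma left_bra_tensor: "left_bra m (u \<otimes>\<^sub>v v) = cinner m u *\<^sub>C v"
  by (rule ell2_eqI) simp

lemma left_bra_ket: "left_bra (ket a) x = bra_fst a x"
  by (rule ell2_eqI) simp

lemma right_bra_ket: "right_bra (ket b) x = bra_snd b x"
  by (rule ell2_eqI) simp

text \<open>Together with its left counterpart this links steering with overlaps: the same number is
  an inner product in either factor.\<close>

lemma cinner_tensor_right_bra: "cinner (m \<otimes>\<^sub>v y) x = cinner m (right_bra y x)"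
proof -
  have "((\<lambda>i. cnj (coord (m \<otimes>\<^sub>v y) i) * coord x i) has_sum cinner (m \<otimes>\<^sub>v y) x) (UNIV \<times> UNIV)"
    using cinner_has_sum[of "m \<otimes>\<^sub>v y" x] by simp
  moreover have "((\<lambda>b. cnj (coord (m \<otimes>\<^sub>v y) (a, b)) * coord x (a, b)) has_sum
      cnj (coord m a) * coord (right_bra y x) a) UNIV" for a
    using has_sum_cmult_right[OF cinner_has_sum[of y "bra_fst a x"], of "cnj (coord m a)"]
    by (simp add: mult.assoc)
  ultimately have "((\<lambda>a. cnj (coord m a) * coord (right_bra y x) a) has_sum cinner (m \<otimes>\<^sub>v y) x) UNIV"
    by (rule has_sum_SigmaD)
  then show ?thesis using cinner_has_sum has_sum_unique by blast
qed

lemma cinner_tensor_left_bra: "cinner (m \<otimes>\<^sub>v y) x = cinner y (left_bra m x)"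
proof -
  have "((\<lambda>(a, b). cnj (coord (m \<otimes>\<^sub>v y) (a, b)) * coord x (a, b)) has_sum cinner (m \<otimes>\<^sub>v y) x) UNIV"
    using cinner_has_sum[of "m \<otimes>\<^sub>v y" x] by (simp add: case_prod_unfold)
  then have "((\<lambda>(b, a). cnj (coord (m \<otimes>\<^sub>v y) (a, b)) * coord x (a, b)) has_sum cinner (m \<otimes>\<^sub>v y) x) (UNIV \<times> UNIV)"
    by (subst (asm) has_sum_swap_UNIV) simp
  moreover have "((\<lambda>a. case (b, a) of (b, a) \<Rightarrow> cnj (coord (m \<otimes>\<^sub>v y) (a, b)) * coord x (a, b)) has_sum
      cnj (coord y b) * coord (left_bra m x) b) UNIV" for b
    using has_sum_cmult_right[OF cinner_has_sum[of m "bra_snd b x"], of "cnj (coord y b)"]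
    by (simp add: mult_ac)
  ultimately have "((\<lambda>b. cnj (coord y b) * coord (left_bra m x) b) has_sum cinner (m \<otimes>\<^sub>v y) x) UNIV"
    by (rule has_sum_SigmaD)
  then show ?thesis using cinner_has_sum has_sum_unique by blast
qed

lemma norm_tensor: "norm (u \<otimes>\<^sub>v v) = norm u * norm v"
proof -
  have "complex_of_real ((norm (u \<otimes>\<^sub>v v))\<^sup>2) = of_real ((norm u * norm v)\<^sup>2)"
    unfolding cinner_self_norm[symmetric] cinner_tensor_left_bra left_bra_tensor
    by (simp add: cinner_self_norm power_mult_distrib)
  then have "(norm (u \<otimes>\<^sub>v v))\<^sup>2 = (norm u * norm v)\<^sup>2" using of_real_eq_iff by blast
  then show ?thesis by (simp add: power2_eq_iff_nonneg)
qed

interpretation tensor: bounded_bilinear "tensor :: 'a ell2 \<Rightarrow> 'b ell2 \<Rightarrow> ('a \<times> 'b) ell2"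
proof
  fix x x' :: "'a ell2" and y y' :: "'b ell2" and r :: real
  show "(x + x') \<otimes>\<^sub>v y = x \<otimes>\<^sub>v y + x' \<otimes>\<^sub>v y" "x \<otimes>\<^sub>v (y + y') = x \<otimes>\<^sub>v y + x \<otimes>\<^sub>v y'"
    "(r *\<^sub>R x) \<otimes>\<^sub>v y = r *\<^sub>R (x \<otimes>\<^sub>v y)" "x \<otimes>\<^sub>v (r *\<^sub>R y) = r *\<^sub>R (x \<otimes>\<^sub>v y)"
    by (rule ell2_eqI; simp add: algebra_simps)+
  show "\<exists>K. \<forall>(x :: 'a ell2) (y :: 'b ell2). norm (x \<otimes>\<^sub>v y) \<le> norm x * norm y * K"
    by (intro exI[of _ 1]) (simp add: norm_tensor)
qed

lemma tensor_scaleC: "(c *\<^sub>C x) \<otimes>\<^sub>v y = c *\<^sub>C (x \<otimes>\<^sub>v y)" "x \<otimes>\<^sub>v (c *\<^sub>C y) = c *\<^sub>C (x \<otimes>\<^sub>v y)"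
  by (rule ell2_eqI; simp)+

section \<open>Operators on one tensor factor, assembled from slices\<close>

definition glue_snd :: "('b \<Rightarrow> 'a ell2) \<Rightarrow> ('a \<times> 'b) ell2" where
  "glue_snd v = Abs_ell2 (\<lambda>(a, b). coord (v b) a)"

definition glue_fst :: "('a \<Rightarrow> 'b ell2) \<Rightarrow> ('a \<times> 'b) ell2" where
  "glue_fst v = Abs_ell2 (\<lambda>(a, b). coord (v a) b)"

lemma coord_glue_fst:
  assumes "(\<lambda>a. (norm (v a))\<^sup>2) summable_on UNIV"
  shows "coord (glue_fst v) (a, b) = coord (v a) b"
proof -
  have "((\<lambda>a. (norm (v a))\<^sup>2) has_sum (\<Sum>\<^sub>\<infinity>a. (norm (v a))\<^sup>2)) UNIV"
    by (rule has_sum_infsum[OF assms])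
  then have "((\<lambda>(a, b). (cmod (coord (v a) b))\<^sup>2) has_sum (\<Sum>\<^sub>\<infinity>a. (norm (v a))\<^sup>2)) UNIV"
    using has_sum_iterated_nonneg[of "\<lambda>a b. (cmod (coord (v a) b))\<^sup>2"] norm_sq_has_sum by fastforce
  then have "(\<lambda>i. (cmod (case i of (a, b) \<Rightarrow> coord (v a) b))\<^sup>2) summable_on UNIV"
    by (auto simp: case_prod_unfold dest: has_sum_imp_summable)
  then show ?thesis by (simp add: glue_fst_def coord_Abs_ell2)
qed

lemma coord_glue_snd:
  assumes "(\<lambda>b. (norm (v b))\<^sup>2) summable_on UNIV"
  shows "coord (glue_snd v) (a, b) = coord (v b) a"
proof -
  have "((\<lambda>b. (norm (v b))\<^sup>2) has_sum (\<Sum>\<^sub>\<infinity>b. (norm (v b))\<^sup>2)) UNIV"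
    by (rule has_sum_infsum[OF assms])
  then have "((\<lambda>(b, a). (cmod (coord (v b) a))\<^sup>2) has_sum (\<Sum>\<^sub>\<infinity>b. (norm (v b))\<^sup>2)) UNIV"
    using has_sum_iterated_nonneg[of "\<lambda>b a. (cmod (coord (v b) a))\<^sup>2"] norm_sq_has_sum by fastforce
  then have "((\<lambda>(a, b). (cmod (coord (v b) a))\<^sup>2) has_sum (\<Sum>\<^sub>\<infinity>b. (norm (v b))\<^sup>2)) UNIV"
    by (subst (asm) has_sum_swap_UNIV)
  then have "(\<lambda>i. (cmod (case i of (a, b) \<Rightarrow> coord (v b) a))\<^sup>2) summable_on UNIV"
    by (auto simp: case_prod_unfold dest: has_sum_imp_summable)
  then show ?thesis by (simp add: glue_snd_def coord_Abs_ell2)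
qed

lemma bra_fst_glue_fst:
  assumes "(\<lambda>a. (norm (v a))\<^sup>2) summable_on UNIV"
  shows "bra_fst a (glue_fst v) = v a"
  by (rule ell2_eqI) (simp add: coord_glue_fst[OF assms])

lemma bra_snd_glue_snd:
  assumes "(\<lambda>b. (norm (v b))\<^sup>2) summable_on UNIV"
  shows "bra_snd b (glue_snd v) = v b"
  by (rule ell2_eqI) (simp add: coord_glue_snd[OF assms])

lemma norm_le_slices:
  assumes "((\<lambda>i. (norm (v i))\<^sup>2) has_sum s\<^sup>2) UNIV" "((\<lambda>i. (norm (w i))\<^sup>2) has_sum t\<^sup>2) UNIV"
    and "\<And>i. norm (v i) \<le> K * norm (w i)" "0 \<le> K" "0 \<le> t"
  shows "s \<le> K * t"
proof (rule power2_le_imp_le)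
  have "((\<lambda>i. K\<^sup>2 * (norm (w i))\<^sup>2) has_sum K\<^sup>2 * t\<^sup>2) UNIV"
    by (rule has_sum_cmult_right[OF assms(2)])
  moreover have "(norm (v i))\<^sup>2 \<le> K\<^sup>2 * (norm (w i))\<^sup>2" for i
    using power_mono[OF assms(3)[of i], of 2] by (simp add: power_mult_distrib)
  ultimately show "s\<^sup>2 \<le> (K * t)\<^sup>2"
    using has_sum_mono[OF assms(1)] by (auto simp: power_mult_distrib)
qed (use assms in simp)

lemma norm_sq_summable_image:
  assumes "((\<lambda>i. (norm (w i))\<^sup>2) has_sum s) UNIV" and "\<And>x. norm (T x) \<le> K * norm x"
  shows "(\<lambda>i. (norm (T (w i)))\<^sup>2) summable_on UNIV"
proof (rule summable_on_comparison_test)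
  show "(\<lambda>i. K\<^sup>2 * (norm (w i))\<^sup>2) summable_on UNIV"
    using has_sum_cmult_right[OF assms(1)] by (rule has_sum_imp_summable)
  show "(norm (T (w i)))\<^sup>2 \<le> K\<^sup>2 * (norm (w i))\<^sup>2" for i
    using power_mono[OF assms(2)[of "w i"], of 2] by (simp add: power_mult_distrib)
qed simp

text \<open>\<open>M \<otimes> 1\<close> and \<open>1 \<otimes> N\<close>, acting slicewise.\<close>

definition tensor_left :: "('a ell2 \<Rightarrow> 'a ell2) \<Rightarrow> ('a \<times> 'b) ell2 \<Rightarrow> ('a \<times> 'b) ell2" where
  "tensor_left M x = glue_snd (\<lambda>b. M (bra_snd b x))"

definition tensor_right :: "('b ell2 \<Rightarrow> 'b ell2) \<Rightarrow> ('a \<times> 'b) ell2 \<Rightarrow> ('a \<times> 'b) ell2" where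
  "tensor_right N x = glue_fst (\<lambda>a. N (bra_fst a x))"

lemma bra_snd_tensor_left:
  assumes "bounded_clinear M"
  shows "bra_snd b (tensor_left M x) = M (bra_snd b x)"
proof -
  obtain K where "\<And>x. norm (M x) \<le> K * norm x" using bounded_clinear_bound[OF assms] by metis
  then show ?thesis unfolding tensor_left_def
    by (intro bra_snd_glue_snd norm_sq_summable_image[OF norm_bra_snd_has_sum])
qed

lemma bra_fst_tensor_right:
  assumes "bounded_clinear N"
  shows "bra_fst a (tensor_right N x) = N (bra_fst a x)"
proof -
  obtain K where "\<And>x. norm (N x) \<le> K * norm x" using bounded_clinear_bound[OF assms] by metis
  then show ?thesis unfolding tensor_right_def
    by (intro bra_fst_glue_fst norm_sq_summable_image[OF norm_bra_fst_has_sum])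
qed

lemma bra_snd_eqI: "(\<And>b. bra_snd b x = bra_snd b y) \<Longrightarrow> x = y"
  by (rule ell2_eqI) (metis bra_snd.rep_eq surj_pair)

lemma bra_fst_eqI: "(\<And>a. bra_fst a x = bra_fst a y) \<Longrightarrow> x = y"
  by (rule ell2_eqI) (metis bra_fst.rep_eq surj_pair)

lemma norm_tensor_left_le:
  assumes "bounded_clinear M" and K: "\<And>x. norm (M x) \<le> K * norm x" "0 \<le> K"
  shows "norm (tensor_left M x) \<le> K * norm x"
  by (rule norm_le_slices[OF norm_bra_snd_has_sum norm_bra_snd_has_sum])
    (simp_all add: bra_snd_tensor_left[OF assms(1)] K)

lemma norm_tensor_right_le:
  assumes "bounded_clinear N" and K: "\<And>x. norm (N x) \<le> K * norm x" "0 \<le> K"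
  shows "norm (tensor_right N x) \<le> K * norm x"
  by (rule norm_le_slices[OF norm_bra_fst_has_sum norm_bra_fst_has_sum])
    (simp_all add: bra_fst_tensor_right[OF assms(1)] K)

lemma bounded_clinear_tensor_left:
  assumes M: "bounded_clinear M"
  shows "bounded_clinear (tensor_left M)"
proof -
  obtain K where K: "\<And>x. norm (M x) \<le> K * norm x" "0 \<le> K"
    using bounded_clinear_bound[OF M] by metis
  show ?thesis
    by (rule bounded_clinearI[OF _ _ norm_tensor_left_le[OF M K]]; rule bra_snd_eqI;
      simp add: bra_snd_tensor_left[OF M] bounded_clinear_simps[OF M])
qed

lemma bounded_clinear_tensor_right:
  assumes N: "bounded_clinear N"
  shows "bounded_clinear (tensor_right N)"
proof -
  obtain K where K: "\<And>x. norm (N x) \<le> K * norm x" "0 \<le> K"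
    using bounded_clinear_bound[OF N] by metis
  show ?thesis
    by (rule bounded_clinearI[OF _ _ norm_tensor_right_le[OF N K]]; rule bra_fst_eqI;
      simp add: bra_fst_tensor_right[OF N] bounded_clinear_simps[OF N])
qed

lemma tensor_left_tensor:
  assumes M: "bounded_clinear M"
  shows "tensor_left M (u \<otimes>\<^sub>v v) = M u \<otimes>\<^sub>v v"
  by (rule bra_snd_eqI) (simp add: bra_snd_tensor_left[OF M] bounded_clinear_simps[OF M])

lemma tensor_right_tensor:
  assumes N: "bounded_clinear N"
  shows "tensor_right N (u \<otimes>\<^sub>v v) = u \<otimes>\<^sub>v N v"
  by (rule bra_fst_eqI) (simp add: bra_fst_tensor_right[OF N] bounded_clinear_simps[OF N])

text \<open>The series that defines \<open>\<otimes>\<^sub>o\<close> is the ket expansion of a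
  bounded operator already built slice by slice, and therefore it converges.\<close>

lemma tensor_op_eq:
  assumes M: "bounded_clinear M" and N: "bounded_clinear N"
  shows "(M \<otimes>\<^sub>o N) x = tensor_left M (tensor_right N x)"
proof -
  have "((\<lambda>i. coord x i *\<^sub>C tensor_left M (tensor_right N (ket i))) has_sum
      tensor_left M (tensor_right N x)) UNIV"
    by (rule bounded_clinear_has_sum_ket[OF bounded_clinear_comp[OF
          bounded_clinear_tensor_left[OF M] bounded_clinear_tensor_right[OF N]]])
  moreover have "tensor_left M (tensor_right N (ket i)) = M (ket (fst i)) \<otimes>\<^sub>v N (ket (snd i))" for i
    by (cases i) (simp add: ket_tensor[symmetric] tensor_left_tensor[OF M] tensor_right_tensor[OF N])
  ultimately have "((\<lambda>(a, b). coord x (a, b) *\<^sub>C (M (ket a) \<otimes>\<^sub>v N (ket b))) has_sum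
      tensor_left M (tensor_right N x)) UNIV"
    by (simp add: case_prod_unfold)
  then show ?thesis unfolding tensor_op_def by (rule infsumI)
qed

lemma bounded_clinear_tensor_op:
  assumes "bounded_clinear M" "bounded_clinear N"
  shows "bounded_clinear (M \<otimes>\<^sub>o N)"
  using bounded_clinear_comp[OF bounded_clinear_tensor_left bounded_clinear_tensor_right, OF assms]
  by (simp add: tensor_op_eq[OF assms, abs_def])

lemma tensor_op_ket:
  assumes "bounded_clinear M" "bounded_clinear N"
  shows "(M \<otimes>\<^sub>o N) (ket i) = M (ket (fst i)) \<otimes>\<^sub>v N (ket (snd i))"
proof -
  have "(M \<otimes>\<^sub>o N) (ket (a, b)) = M (ket a) \<otimes>\<^sub>v N (ket b)" for a b
    by (simp add: tensor_op_eq assms tensor_left_tensor tensor_right_tensor flip: ket_tensor)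
  from this[of "fst i" "snd i"] show ?thesis by simp
qed

lemma norm_tensor_op_le:
  assumes "bounded_clinear M" "\<And>x. norm (M x) \<le> K * norm x" "0 \<le> K"
    and "bounded_clinear N" "\<And>x. norm (N x) \<le> L * norm x" "0 \<le> L"
  shows "norm ((M \<otimes>\<^sub>o N) x) \<le> K * L * norm x"
proof -
  have "norm ((M \<otimes>\<^sub>o N) x) \<le> K * norm (tensor_right N x)"
    unfolding tensor_op_eq[OF assms(1,4)] by (rule norm_tensor_left_le[OF assms(1-3)])
  also have "\<dots> \<le> K * (L * norm x)"
    by (intro mult_left_mono norm_tensor_right_le assms)
  finally show ?thesis by simp
qed

text \<open>A rank-one element on the first factor leaves the second factor in the conditional
  vector \<open>left_bra m x\<close>. Both sides are bounded, so agreement on kets suffices.\<close>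

lemma tensor_op_proj:
  assumes N: "bounded_clinear N"
  shows "(proj m \<otimes>\<^sub>o N) x = m \<otimes>\<^sub>v N (left_bra m x)"
proof (rule bounded_clinear_eqI[where S = "proj m \<otimes>\<^sub>o N" and T = "\<lambda>x. m \<otimes>\<^sub>v N (left_bra m x)"])
  show "bounded_clinear (proj m \<otimes>\<^sub>o N)"
    by (intro bounded_clinear_tensor_op bounded_clinear_proj N)
  have "bounded_clinear (\<lambda>y. m \<otimes>\<^sub>v y)"
    by (rule bounded_clinearI[of _ "norm m"])
      (simp_all add: tensor.add_right tensor_scaleC norm_tensor)
  then show "bounded_clinear (\<lambda>x. m \<otimes>\<^sub>v N (left_bra m x))"
    by (rule bounded_clinear_comp[OF _ bounded_clinear_comp[OF N bounded_clinear_left_bra]])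
  show "(proj m \<otimes>\<^sub>o N) (ket i) = m \<otimes>\<^sub>v N (left_bra m (ket i))" for i
    using ket_tensor[of "fst i" "snd i"] left_bra_tensor[of m "ket (fst i)" "ket (snd i)"]
    by (simp add: tensor_op_ket bounded_clinear_proj N proj_def tensor_scaleC bounded_clinear_simps[OF N])
qed

lemma tensor_op_proj_form:
  assumes "bounded_clinear N"
  shows "cinner x ((proj m \<otimes>\<^sub>o N) x) = cinner (left_bra m x) (N (left_bra m x))"
  by (metis assms cinner_commute cinner_tensor_left_bra tensor_op_proj)

text \<open>After \<open>n\<close> Cholesky steps on \<open>M\<close>, the form is a sum of
  \<open>n\<close> conditional forms of \<open>N\<close> plus the form of the remainder tensored
  with \<open>N\<close>, which tends strongly to zero.\<close>

lemma tensor_op_form_sums: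
  assumes M: "positive_op M" and N: "positive_op N" and e: "ket ` I \<subseteq> range e"
    and x: "\<And>a b. a \<notin> I \<Longrightarrow> coord x (a, b) = 0"
  defines "y \<equiv> \<lambda>j. left_bra (chol_vec M e j) x"
  shows "(\<lambda>j. cinner (y j) (N (y j))) sums cinner x ((M \<otimes>\<^sub>o N) x)"
proof -
  let ?R = "chol_rest M e"
  note bM = positive_op_bounded[OF M] and bN = positive_op_bounded[OF N]
    and bR = positive_op_bounded[OF positive_op_chol_rest[OF M]]
  obtain K where K: "0 \<le> K" "\<And>x. Re (cinner x (M x)) \<le> K * (norm x)\<^sup>2"
    using positive_op_bound[OF M] by metis
  obtain L where L: "0 \<le> L" "\<And>x. norm (N x) \<le> L * norm x"
    using bounded_clinear_bound[OF bN] by metis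
  have R: "norm (?R n x) \<le> K * norm x" for n x
    by (rule positive_op_norm_bound[OF positive_op_chol_rest[OF M]])
      (use chol_rest_bound[OF M] K order_trans in blast)
  have lim: "(\<lambda>n. (?R n \<otimes>\<^sub>o N) x) \<longlonglongrightarrow> 0"
  \<comment> \<open>Only the first index is constrained: the remainders act on the first factor
    while \<open>N\<close> stays fixed.\<close>
  proof (rule tendsto_zero_if_ket[where I = "I \<times> UNIV" and K = "K * L"])
    show "bounded_clinear (?R n \<otimes>\<^sub>o N)" for n
      by (intro bounded_clinear_tensor_op bR bN)
    show "norm ((?R n \<otimes>\<^sub>o N) x) \<le> K * L * norm x" for n x
      by (intro norm_tensor_op_le bR bN R K L)
    show "(\<lambda>n. (?R n \<otimes>\<^sub>o N) (ket i)) \<longlonglongrightarrow> 0" if "i \<in> I \<times> UNIV" for i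
    proof -
      have "(\<lambda>n. ?R n (ket (fst i))) \<longlonglongrightarrow> 0"
        by (rule chol_rest_tendsto[OF M e]) (use that in auto)
      then have "(\<lambda>n. ?R n (ket (fst i)) \<otimes>\<^sub>v N (ket (snd i))) \<longlonglongrightarrow> 0 \<otimes>\<^sub>v N (ket (snd i))"
        by (intro tensor.tendsto tendsto_const)
      then show ?thesis by (simp add: tensor_op_ket[OF bR bN] tensor.zero_left)
    qed
  qed (use x in auto)
  have "(M \<otimes>\<^sub>o N) x - (?R n \<otimes>\<^sub>o N) x = (\<Sum>j<n. (proj (chol_vec M e j) \<otimes>\<^sub>o N) x)" for n
  proof (rule bounded_clinear_eqI[where T = "\<lambda>x. \<Sum>j<n. (proj (chol_vec M e j) \<otimes>\<^sub>o N) x"])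
    show "bounded_clinear (\<lambda>x. (M \<otimes>\<^sub>o N) x - (?R n \<otimes>\<^sub>o N) x)"
      by (intro bounded_clinear_diff bounded_clinear_tensor_op bM bN bR)
    show "bounded_clinear (\<lambda>x. \<Sum>j<n. (proj (chol_vec M e j) \<otimes>\<^sub>o N) x)"
      by (intro bounded_clinear_sum bounded_clinear_tensor_op bounded_clinear_proj bN)
    show "(M \<otimes>\<^sub>o N) (ket i) - (?R n \<otimes>\<^sub>o N) (ket i) = (\<Sum>j<n. (proj (chol_vec M e j) \<otimes>\<^sub>o N) (ket i))" for i
      unfolding tensor_op_ket[OF bM bN] tensor_op_ket[OF bR bN] tensor_op_ket[OF bounded_clinear_proj bN]
        tensor.diff_left[symmetric] tensor.sum_left[symmetric]
      by (subst chol_decomp[of M _ e n]) simp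
  qed
  then have "cinner x ((M \<otimes>\<^sub>o N) x) - cinner x ((?R n \<otimes>\<^sub>o N) x) = (\<Sum>j<n. cinner (y j) (N (y j)))" for n
    by (simp add: y_def flip: cinner.diff_right) (simp add: cinner.sum_right tensor_op_proj_form[OF bN])
  moreover have "(\<lambda>n. cinner x ((M \<otimes>\<^sub>o N) x) - cinner x ((?R n \<otimes>\<^sub>o N) x)) \<longlonglongrightarrow> cinner x ((M \<otimes>\<^sub>o N) x) - cinner x 0"
    by (intro tendsto_intros cinner.tendsto lim)
  ultimately show ?thesis by (simp add: sums_def)
qed

lemma countable_support: "countable {i. coord x i \<noteq> 0}"
  using summable_countable_real[OF coord_sq_summable[of x]] by simp

lemma enumerate_kets:
  assumes "countable I"
  obtains e :: "nat \<Rightarrow> 'a ell2" where "ket ` I \<subseteq> range e"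
  by (rule that[OF subset_range_from_nat_into[OF countable_image[OF assms]]])

text \<open>Factorizing \<open>M\<close> along the first indices in the support of \<open>x\<close>
  displays the form as a series of values of the form of \<open>N\<close>.\<close>

lemma tensor_op_form_nonneg:
  assumes M: "positive_op M" and N: "positive_op N"
  shows "0 \<le> Re (cinner x ((M \<otimes>\<^sub>o N) x))"
proof -
  define I where "I = fst ` {i. coord x i \<noteq> 0}"
  have "countable I" unfolding I_def using countable_support by (rule countable_image)
  then obtain e :: "nat \<Rightarrow> 'a ell2" where e: "ket ` I \<subseteq> range e" by (rule enumerate_kets)
  have "coord x (a, b) = 0" if "a \<notin> I" for a b
    using that unfolding I_def by force
  note sums_Re[OF tensor_op_form_sums[OF M N e this]]
  from sums_le[OF _ sums_zero this] show ?thesis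
    using positive_op_cinner(1)[OF N] by auto
qed

section \<open>Partial traces and product overlaps\<close>

text \<open>An unnormalized mixture of the vectors \<open>v i\<close>. Both reduced states have this
  shape, with the slices of the purification as \<open>v\<close>; the index type is arbitrary
  because the traced-out basis may be uncountable.\<close>

definition proj_sum :: "('i \<Rightarrow> 'a ell2) \<Rightarrow> 'a ell2 \<Rightarrow> 'a ell2" where
  "proj_sum v x = (\<Sum>\<^sub>\<infinity>i. proj (v i) x)"

context
  fixes v :: "'i \<Rightarrow> 'a ell2"
  assumes v: "(\<lambda>i. (norm (v i))\<^sup>2) summable_on UNIV"
begin

lemma proj_abs_summable: "(\<lambda>i. norm (proj (v i) x)) summable_on UNIV"
  by (rule summable_on_comparison_test[OF summable_on_cmult_left[OF v, of "norm x"]])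
    (simp_all add: norm_proj_le)

lemma proj_sum_has_sum: "((\<lambda>i. proj (v i) x) has_sum proj_sum v x) UNIV"
  unfolding proj_sum_def
  by (rule has_sum_infsum[OF Infinite_Sum.abs_summable_summable[OF proj_abs_summable]])

lemma bounded_clinear_proj_sum: "bounded_clinear (proj_sum v)"
proof (rule bounded_clinearI)
  note simps = bounded_clinear_simps[OF bounded_clinear_proj]
  show "proj_sum v (x + y) = proj_sum v x + proj_sum v y" for x y
    using has_sum_add[OF proj_sum_has_sum[of x] proj_sum_has_sum[of y]] proj_sum_has_sum[of "x + y"]
    by (simp add: simps(1) has_sum_unique)
  show "proj_sum v (c *\<^sub>C x) = c *\<^sub>C proj_sum v x" for c x
    using has_sum_bounded_linear[OF scaleC.bounded_linear_right[of c] proj_sum_has_sum[of x]]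
      proj_sum_has_sum[of "c *\<^sub>C x"]
    by (simp add: simps(4) has_sum_unique)
  show "norm (proj_sum v x) \<le> (\<Sum>\<^sub>\<infinity>i. (norm (v i))\<^sup>2) * norm x" for x
  proof -
    have "norm (proj_sum v x) \<le> (\<Sum>\<^sub>\<infinity>i. norm (proj (v i) x))"
      unfolding proj_sum_def by (rule norm_infsum_bound[OF proj_abs_summable])
    also have "\<dots> \<le> (\<Sum>\<^sub>\<infinity>i. (norm (v i))\<^sup>2 * norm x)"
      by (intro infsum_mono proj_abs_summable summable_on_cmult_left v norm_proj_le)
    also have "\<dots> = (\<Sum>\<^sub>\<infinity>i. (norm (v i))\<^sup>2) * norm x"
      by (rule infsum_cmult_left')
    finally show ?thesis .
  qed
qed

lemma proj_sum_form:
  "((\<lambda>i. complex_of_real ((cmod (cinner (v i) x))\<^sup>2)) has_sum cinner x (proj_sum v x)) UNIV"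
  using has_sum_bounded_linear[OF cinner.bounded_linear_right proj_sum_has_sum, of x x]
  by (simp only: cinner_proj)

lemma proj_sum_form_Re:
  "((\<lambda>i. (cmod (cinner (v i) x))\<^sup>2) has_sum Re (cinner x (proj_sum v x))) UNIV"
  using has_sum_Re[OF proj_sum_form] by simp

lemma positive_op_proj_sum: "positive_op (proj_sum v)"
proof (rule positive_opI[OF bounded_clinear_proj_sum])
  show "cinner x (proj_sum v x) = of_real (Re (cinner x (proj_sum v x)))" for x
    using has_sum_unique[OF proj_sum_form has_sum_of_real[OF proj_sum_form_Re]] .
  show "0 \<le> Re (cinner x (proj_sum v x))" for x
    using proj_sum_form_Re by (rule has_sum_nonneg) simp
qed

text \<open>A double sum of the complex numbers \<open>f i j\<close>, evaluated in both orders: over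
  \<open>j\<close> first it gives the values <v_i|T v_i>, over \<open>i\<close> first the diagonal
  entries of the composite. The majorant \<open>g\<close>, summable because \<open>T\<close> is
  bounded, justifies the exchange.\<close>

lemma trace_comp_proj_sum:
  assumes T: "bounded_clinear T"
  shows "((\<lambda>i. cinner (v i) (T (v i))) has_sum trace (T \<circ> proj_sum v)) UNIV"
proof -
  obtain K where K: "0 \<le> K" "\<And>x. norm (T x) \<le> K * norm x"
    using bounded_clinear_bound[OF T] by metis
  define f where "f i j = cnj (coord (v i) j) * coord (T (v i)) j" for i j
  define g where "g i j = (cmod (coord (v i) j))\<^sup>2 + (cmod (coord (T (v i)) j))\<^sup>2" for i j
  have Tv: "(\<lambda>i. (norm (T (v i)))\<^sup>2) summable_on UNIV"
    using norm_sq_summable_image[OF has_sum_infsum[OF v] K(2)] .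
  have g: "(\<lambda>(i, j). g i j) summable_on UNIV"
  proof (rule has_sum_imp_summable[OF has_sum_iterated_nonneg])
    show "((\<lambda>j. g i j) has_sum ((norm (v i))\<^sup>2 + (norm (T (v i)))\<^sup>2)) UNIV" for i
      unfolding g_def by (intro has_sum_add norm_sq_has_sum)
    show "((\<lambda>i. (norm (v i))\<^sup>2 + (norm (T (v i)))\<^sup>2) has_sum
        (\<Sum>\<^sub>\<infinity>i. (norm (v i))\<^sup>2 + (norm (T (v i)))\<^sup>2)) UNIV"
      by (intro has_sum_infsum summable_on_add v Tv)
  qed (simp add: g_def)
  have le: "cmod (f i j) \<le> g i j" for i j
  proof -
    have "0 \<le> cmod (coord (v i) j) * cmod (coord (T (v i)) j)" by simp
    then show ?thesis
      using sum_squares_bound[of "cmod (coord (v i) j)" "cmod (coord (T (v i)) j)"]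
      unfolding f_def g_def norm_mult complex_mod_cnj by linarith
  qed
  have "(\<lambda>(i, j). f i j) summable_on UNIV"
    by (rule Infinite_Sum.abs_summable_summable[OF Infinite_Sum.abs_summable_on_comparison_test'[OF g]])
      (use le in auto)
  then have S: "((\<lambda>(i, j). f i j) has_sum (\<Sum>\<^sub>\<infinity>(i, j). f i j)) UNIV" (is "(_ has_sum ?S) _")
    by (rule has_sum_infsum)
  have "((\<lambda>i. cinner (v i) (T (v i))) has_sum ?S) UNIV"
    by (rule has_sum_SigmaD[where f = "\<lambda>(i, j). f i j" and B = "\<lambda>_. UNIV"])
      (use S in \<open>simp_all add: f_def cinner_has_sum\<close>)
  moreover have "((\<lambda>j. cinner (ket j) (T (proj_sum v (ket j)))) has_sum ?S) UNIV"
  proof (rule has_sum_SigmaD[where f = "\<lambda>(j, i). f i j" and B = "\<lambda>_. UNIV"])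
    show "((\<lambda>(j, i). f i j) has_sum ?S) (UNIV \<times> UNIV)"
      using S by (subst (asm) has_sum_swap_UNIV) simp
    show "((\<lambda>i. case (j, i) of (j, i) \<Rightarrow> f i j) has_sum cinner (ket j) (T (proj_sum v (ket j)))) UNIV" for j
    proof -
      have "bounded_linear (\<lambda>x. cinner (ket j) (T x))"
        by (rule bounded_linear_compose[OF cinner.bounded_linear_right])
          (use T in \<open>simp add: bounded_clinear_def\<close>)
      from has_sum_bounded_linear[OF this proj_sum_has_sum[of "ket j"]]
      show ?thesis by (simp add: proj_def bounded_clinear_simps[OF T] f_def)
    qed
  qed
  then have "trace (T \<circ> proj_sum v) = ?S"
    unfolding trace_def o_def by (rule infsumI)
  ultimately show ?thesis by simp
qed

end

section \<open>The two reduced states of a pure state\<close>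

lemma proj_bra_fst: "bra_fst a (proj \<psi> (ket a \<otimes>\<^sub>v y)) = proj (bra_fst a \<psi>) y"
  by (metis proj_def slice_simps(2) cinner_commute cinner_tensor_left_bra left_bra_ket)

lemma proj_bra_snd: "bra_snd b (proj \<psi> (x \<otimes>\<^sub>v ket b)) = proj (bra_snd b \<psi>) x"
  by (metis proj_def slice_simps(4) cinner_commute cinner_tensor_right_bra right_bra_ket)

lemma reduced_BC_eq: "reduced_BC \<psi> = proj_sum (\<lambda>a. bra_fst a \<psi>)"
  by (simp add: fun_eq_iff reduced_BC_def ptrace_fst_def proj_sum_def proj_bra_fst)

lemma reduced_AB_eq: "reduced_AB \<psi> = proj_sum (\<lambda>c. bra_snd c (assoc_ell2 \<psi>))"
  by (simp add: fun_eq_iff reduced_AB_def ptrace_snd_def proj_sum_def proj_bra_snd)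

lemma bra_fst_summable: "(\<lambda>a. (norm (bra_fst a x))\<^sup>2) summable_on UNIV"
  using norm_bra_fst_has_sum by (rule has_sum_imp_summable)

lemma bra_snd_summable: "(\<lambda>b. (norm (bra_snd b x))\<^sup>2) summable_on UNIV"
  using norm_bra_snd_has_sum by (rule has_sum_imp_summable)

lemma positive_op_reduced_BC: "positive_op (reduced_BC \<psi>)"
  unfolding reduced_BC_eq by (rule positive_op_proj_sum[OF bra_fst_summable])

text \<open>The amplitudes of \<open>y\<close> on the slices of \<open>\<psi>\<close> are the
  conjugate coordinates of \<open>right_bra y \<psi>\<close>. Both directions use the reduced state
  through this identity: it moves statements about \<open>BC\<close> to vectors of
  \<open>A\<close>.\<close>

lemma reduced_BC_form: "Re (cinner y (reduced_BC \<psi> y)) = (norm (right_bra y \<psi>))\<^sup>2"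
proof -
  have "cmod (cinner (bra_fst a \<psi>) y) = cmod (coord (right_bra y \<psi>) a)" for a
    by (metis cinner_commute complex_mod_cnj coord_right_bra)
  then show ?thesis
    using proj_sum_form_Re[OF bra_fst_summable, of \<psi> y] norm_sq_has_sum[of "right_bra y \<psi>"]
    unfolding reduced_BC_eq by (simp add: has_sum_unique)
qed

lemma trace_reduced_AB:
  assumes "bounded_clinear T"
  shows "((\<lambda>c. Re (cinner (bra_snd c (assoc_ell2 \<psi>)) (T (bra_snd c (assoc_ell2 \<psi>))))) has_sum
    Re (trace (T \<circ> reduced_AB \<psi>))) UNIV"
  unfolding reduced_AB_eq by (intro has_sum_Re trace_comp_proj_sum assms bra_snd_summable)

text \<open>Contracting \<open>A\<close> and slicing \<open>C\<close> commute, so the conditional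
  vectors in the trace over \<open>C\<close> are the slices of one vector on
  \<open>BC\<close>.\<close>

lemma left_bra_assoc: "left_bra m (bra_snd c (assoc_ell2 \<psi>)) = bra_snd c (left_bra m \<psi>)"
proof (rule ell2_eqI)
  fix b
  have "bra_snd b (bra_snd c (assoc_ell2 \<psi>)) = bra_snd (b, c) \<psi>"
    by (rule ell2_eqI) simp
  then show "coord (left_bra m (bra_snd c (assoc_ell2 \<psi>))) b = coord (bra_snd c (left_bra m \<psi>)) b"
    by simp
qed

text \<open>The largest squared Schmidt coefficient of \<open>\<phi>\<close>, which is also the
  squared norm of the antilinear map sending \<open>u\<close> to
  \<open>left_bra u \<phi>\<close>.\<close>

definition max_overlap :: "('b \<times> 'c) ell2 \<Rightarrow> real" where
  "max_overlap \<phi> = Sup {(cmod (cinner (\<chi>\<^sub>1 \<otimes>\<^sub>v \<chi>\<^sub>2) \<phi>))\<^sup>2 | \<chi>\<^sub>1 \<chi>\<^sub>2. norm \<chi>\<^sub>1 = 1 \<and> norm \<chi>\<^sub>2 = 1}"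

lemma geom_ent_pure_eq: "geom_ent_pure \<phi> = 1 - max_overlap \<phi>"
  by (simp add: geom_ent_pure_def max_overlap_def)

lemma overlap_le_norm:
  assumes "norm \<chi>\<^sub>1 = 1" "norm \<chi>\<^sub>2 = 1"
  shows "(cmod (cinner (\<chi>\<^sub>1 \<otimes>\<^sub>v \<chi>\<^sub>2) \<phi>))\<^sup>2 \<le> (norm \<phi>)\<^sup>2"
  using norm_cinner_le[of "\<chi>\<^sub>1 \<otimes>\<^sub>v \<chi>\<^sub>2" \<phi>] assms by (simp add: norm_tensor power_mono)

lemma overlap_bdd_above:
  "bdd_above {(cmod (cinner (\<chi>\<^sub>1 \<otimes>\<^sub>v \<chi>\<^sub>2) \<phi>))\<^sup>2 | \<chi>\<^sub>1 \<chi>\<^sub>2. norm \<chi>\<^sub>1 = 1 \<and> norm \<chi>\<^sub>2 = 1}"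
  by (rule bdd_aboveI[of _ "(norm \<phi>)\<^sup>2"]) (use overlap_le_norm in blast)

lemma overlap_nonempty:
  fixes \<phi> :: "('b \<times> 'c) ell2"
  shows "{(cmod (cinner (\<chi>\<^sub>1 \<otimes>\<^sub>v \<chi>\<^sub>2) \<phi>))\<^sup>2 | \<chi>\<^sub>1 \<chi>\<^sub>2. norm \<chi>\<^sub>1 = 1 \<and> norm \<chi>\<^sub>2 = 1} \<noteq> {}"
proof -
  have "norm (ket undefined :: 'b ell2) = 1 \<and> norm (ket undefined :: 'c ell2) = 1" by simp
  then show ?thesis by blast
qed

lemma overlap_le_max:
  assumes "norm \<chi>\<^sub>1 = 1" "norm \<chi>\<^sub>2 = 1"
  shows "(cmod (cinner (\<chi>\<^sub>1 \<otimes>\<^sub>v \<chi>\<^sub>2) \<phi>))\<^sup>2 \<le> max_overlap \<phi>"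
  unfolding max_overlap_def using assms by (intro cSup_upper overlap_bdd_above) auto

lemma max_overlap_le: "max_overlap \<phi> \<le> (norm \<phi>)\<^sup>2"
  unfolding max_overlap_def by (rule cSup_least[OF overlap_nonempty]) (use overlap_le_norm in blast)

lemma max_overlap_nonneg: "0 \<le> max_overlap \<phi>"
  by (rule order_trans[OF zero_le_power2 overlap_le_max[OF norm_ket norm_ket]])

text \<open>By Cauchy-Schwarz the second vector of a product can be eliminated; what remains is the
  state that Bob prepares.\<close>

lemma max_overlap_approx:
  assumes "0 < \<epsilon>"
  obtains \<xi> where "norm \<xi> = 1" "max_overlap \<phi> - \<epsilon> < (norm (left_bra \<xi> \<phi>))\<^sup>2"
proof -
  obtain \<chi>\<^sub>1 :: "'a ell2" and \<chi>\<^sub>2 :: "'b ell2" where \<xi>: "norm \<chi>\<^sub>1 = 1" "norm \<chi>\<^sub>2 = 1"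
    "max_overlap \<phi> - \<epsilon> < (cmod (cinner (\<chi>\<^sub>1 \<otimes>\<^sub>v \<chi>\<^sub>2) \<phi>))\<^sup>2"
    using less_cSup_iff[OF overlap_nonempty[of \<phi>] overlap_bdd_above[of \<phi>], of "max_overlap \<phi> - \<epsilon>"] assms
    by (auto simp: max_overlap_def)
  have "cmod (cinner (\<chi>\<^sub>1 \<otimes>\<^sub>v \<chi>\<^sub>2) \<phi>) \<le> norm (left_bra \<chi>\<^sub>1 \<phi>)"
    using norm_cinner_le[of \<chi>\<^sub>2 "left_bra \<chi>\<^sub>1 \<phi>"] \<xi>(2) by (simp add: cinner_tensor_left_bra)
  then show ?thesis using that \<xi> power_mono[of "cmod (cinner (\<chi>\<^sub>1 \<otimes>\<^sub>v \<chi>\<^sub>2) \<phi>)" _ 2] by fastforce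
qed

text \<open>For given \<open>u\<close> the best partner is \<open>left_bra u \<phi>\<close> itself:
  testing the overlap with the product of the two normalized vectors attains the norm.\<close>

lemma norm_left_bra_le_max_overlap: "(norm (left_bra u \<phi>))\<^sup>2 \<le> (norm u)\<^sup>2 * max_overlap \<phi>"
proof (cases "left_bra u \<phi> = 0")
  case True
  then show ?thesis by (simp add: max_overlap_nonneg)
next
  case False
  define w where "w = left_bra u \<phi>"
  have "u \<noteq> 0" using False norm_left_bra_le[of u \<phi>] by auto
  have "w \<noteq> 0" using False by (simp add: w_def)
  have *: "cmod (cinner (u \<otimes>\<^sub>v w) \<phi>) = (norm w)\<^sup>2"
    by (simp add: cinner_tensor_left_bra cinner_self_norm norm_power flip: w_def)
  have "(cmod (cinner ((u /\<^sub>R norm u) \<otimes>\<^sub>v (w /\<^sub>R norm w)) \<phi>))\<^sup>2 \<le> max_overlap \<phi>"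
    using \<open>u \<noteq> 0\<close> \<open>w \<noteq> 0\<close> by (intro overlap_le_max) simp_all
  also have "cmod (cinner ((u /\<^sub>R norm u) \<otimes>\<^sub>v (w /\<^sub>R norm w)) \<phi>) = (norm w)\<^sup>2 / (norm u * norm w)"
    by (simp add: tensor.scaleR_left tensor.scaleR_right cinner.scaleR_left * divide_inverse mult_ac)
  also have "\<dots> = norm w / norm u" using \<open>w \<noteq> 0\<close> by (simp add: power2_eq_square)
  finally show ?thesis using \<open>u \<noteq> 0\<close> by (simp add: power_divide field_simps flip: w_def)
qed

lemma has_sum_sum:
  fixes f :: "'i \<Rightarrow> 'a \<Rightarrow> 'b :: topological_comm_monoid_add"
  assumes "finite F" "\<And>k. k \<in> F \<Longrightarrow> (f k has_sum s k) A"
  shows "((\<lambda>a. \<Sum>k\<in>F. f k a) has_sum (\<Sum>k\<in>F. s k)) A"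
  using assms by (induction F) (auto intro!: has_sum_add)

text \<open>The left-hand side sums to \<open>Tr[\<mu> Tr\<^sub>C |\<phi>\<rangle>\<langle>\<phi>|]\<close>. Factorize \<open>\<mu> = \<Sum>\<^sub>k |u\<^sub>k\<rangle>\<langle>u\<^sub>k|\<close> and use
  \<open>\<Sum>\<^sub>k \<parallel>u\<^sub>k\<parallel>\<^sup>2 \<le> Tr \<mu> = 1\<close>.\<close>

lemma density_overlap:
  assumes \<mu>: "density_op \<mu>"
  obtains s where "((\<lambda>c. Re (cinner (bra_snd c \<phi>) (\<mu> (bra_snd c \<phi>)))) has_sum s) UNIV"
    "s \<le> max_overlap \<phi>"
proof -
  have pos: "positive_op \<mu>" using \<mu> by (simp add: density_op_def)
  \<comment> \<open>All slices of \<open>\<phi>\<close> are supported in \<open>J\<close>, so one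
    factorization of \<open>\<mu>\<close> serves every \<open>c\<close>.\<close>
  define J where "J = fst ` {i. coord \<phi> i \<noteq> 0}"
  have "countable J" unfolding J_def using countable_support by (rule countable_image)
  then obtain e :: "nat \<Rightarrow> 'a ell2" where e: "ket ` J \<subseteq> range e" by (rule enumerate_kets)
  have J: "coord (bra_snd c \<phi>) b = 0" if "b \<notin> J" for b c
    using that unfolding J_def by force
  define u where "u = chol_vec \<mu> e"
  \<comment> \<open>An inequality rather than an equality, as the factorization may miss the part of
    \<open>\<mu>\<close> outside \<open>J\<close>.\<close>
  have u_le: "(\<Sum>k\<in>F. (norm (u k))\<^sup>2) \<le> 1" if F: "finite F" for F
  proof (rule has_sum_mono)
    obtain n where n: "F \<subseteq> {..<n}" using finite_nat_iff_bounded F by blast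
    show "((\<lambda>b. \<Sum>k\<in>F. (cmod (coord (u k) b))\<^sup>2) has_sum (\<Sum>k\<in>F. (norm (u k))\<^sup>2)) UNIV"
      by (intro has_sum_sum norm_sq_has_sum F)
    show "((\<lambda>b. Re (cinner (ket b) (\<mu> (ket b)))) has_sum 1) UNIV"
      using has_sum_Re[OF conjunct2[OF \<mu>[unfolded density_op_def]]] by simp
    fix b
    have "(\<Sum>k\<in>F. (cmod (coord (u k) b))\<^sup>2) \<le> (\<Sum>k<n. (cmod (cinner (u k) (ket b)))\<^sup>2)"
      using sum_mono2[OF _ n, of "\<lambda>k. (cmod (coord (u k) b))\<^sup>2"] by simp
    also have "\<dots> \<le> Re (cinner (ket b) (\<mu> (ket b)))"
      unfolding u_def by (rule chol_partial_bound[OF pos])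
    finally show "(\<Sum>k\<in>F. (cmod (coord (u k) b))\<^sup>2) \<le> Re (cinner (ket b) (\<mu> (ket b)))" .
  qed
  have le: "(\<Sum>k\<in>F. (norm (left_bra (u k) \<phi>))\<^sup>2) \<le> max_overlap \<phi>" if F: "finite F" for F
  proof -
    have "(\<Sum>k\<in>F. (norm (left_bra (u k) \<phi>))\<^sup>2) \<le> (\<Sum>k\<in>F. (norm (u k))\<^sup>2) * max_overlap \<phi>"
      unfolding sum_distrib_right by (intro sum_mono norm_left_bra_le_max_overlap)
    also have "\<dots> \<le> 1 * max_overlap \<phi>"
      by (rule mult_right_mono[OF u_le[OF F] max_overlap_nonneg])
    finally show ?thesis by simp
  qed
  have summable: "(\<lambda>k. (norm (left_bra (u k) \<phi>))\<^sup>2) summable_on UNIV"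
    by (rule nonneg_bdd_above_summable_on) (use le in \<open>auto intro!: bdd_aboveI\<close>)
  define s where "s = (\<Sum>\<^sub>\<infinity>k. (norm (left_bra (u k) \<phi>))\<^sup>2)"
  have s: "((\<lambda>k. (norm (left_bra (u k) \<phi>))\<^sup>2) has_sum s) UNIV"
    unfolding s_def by (rule has_sum_infsum[OF summable])
  \<comment> \<open>Squared overlaps of the \<open>u k\<close> with the slices of
    \<open>\<phi>\<close>, summed over \<open>c\<close> on the left and over \<open>k\<close> on the
    right.\<close>
  have "((\<lambda>k. (norm (left_bra (u k) \<phi>))\<^sup>2) has_sum s) UNIV
      \<longleftrightarrow> ((\<lambda>c. Re (cinner (bra_snd c \<phi>) (\<mu> (bra_snd c \<phi>)))) has_sum s) UNIV"
  proof (rule has_sum_swap_nonneg)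
    show "((\<lambda>c. (cmod (cinner (u k) (bra_snd c \<phi>)))\<^sup>2) has_sum (norm (left_bra (u k) \<phi>))\<^sup>2) UNIV" for k
      by (rule norm_left_bra_has_sum)
    show "((\<lambda>k. (cmod (cinner (u k) (bra_snd c \<phi>)))\<^sup>2) has_sum
        Re (cinner (bra_snd c \<phi>) (\<mu> (bra_snd c \<phi>)))) UNIV" for c
      unfolding u_def using chol_form_sums[OF pos e J] by (simp add: sums_nonneg_has_sum_iff)
  qed simp
  moreover have "s \<le> max_overlap \<phi>"
    unfolding s_def by (rule infsum_le_finite_sums[OF summable]) (use le in auto)
  ultimately show ?thesis using that s by blast
qed

section \<open>From measurements to decompositions\<close>

text \<open>An ensemble needs unit vectors even where its weight is zero; the default for the zero
  vector is harmless because it is always multiplied by \<open>norm f\<close> or its square.\<close>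

definition normalized :: "'a ell2 \<Rightarrow> 'a ell2" where
  "normalized f = (if f = 0 then ket undefined else f /\<^sub>R norm f)"

lemma norm_normalized [simp]: "norm (normalized f) = 1"
  by (simp add: normalized_def)

lemma scaleR_normalized: "norm f *\<^sub>R normalized f = f"
  by (simp add: normalized_def)

lemma proj_normalized: "(norm f)\<^sup>2 *\<^sub>R proj (normalized f) x = proj f x"
proof -
  have "proj (r *\<^sub>R w) x = r\<^sup>2 *\<^sub>R proj w x" for r :: real and w
    by (simp add: proj_def cinner.scaleR_left scaleC.scaleR_left scaleC.scaleR_right power2_eq_square)
  from this[of "norm f" "normalized f"] show ?thesis by (simp add: scaleR_normalized)
qed

lemma density_overlap_scaled:
  assumes \<mu>: "density_op \<mu>"
  obtains s where "((\<lambda>c. Re (cinner (bra_snd c f) (\<mu> (bra_snd c f)))) has_sum s) UNIV"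
    "s \<le> (norm f)\<^sup>2 * max_overlap (normalized f)"
proof -
  have lin: "bounded_clinear \<mu>" using \<mu> by (simp add: density_op_def positive_op_def)
  obtain s where s: "((\<lambda>c. Re (cinner (bra_snd c (normalized f)) (\<mu> (bra_snd c (normalized f))))) has_sum s) UNIV"
    "s \<le> max_overlap (normalized f)"
    using density_overlap[OF \<mu>, of "normalized f"] by metis
  have "bra_snd c f = norm f *\<^sub>R bra_snd c (normalized f)" for c
    by (subst scaleR_normalized[of f, symmetric]) (rule ell2_eqI, simp)
  then have "Re (cinner (bra_snd c f) (\<mu> (bra_snd c f)))
      = (norm f)\<^sup>2 * Re (cinner (bra_snd c (normalized f)) (\<mu> (bra_snd c (normalized f))))" for c
    by (simp add: bounded_clinear_simps[OF lin] cinner.scaleR_left cinner.scaleR_right power2_eq_square)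
  then show ?thesis
    using that[of "(norm f)\<^sup>2 * s"] has_sum_cmult_right[OF s(1), of "(norm f)\<^sup>2"] s(2)
    by (simp add: mult_left_mono)
qed

lemma geom_ent_pure_bounds:
  assumes "norm \<phi> = 1"
  shows "0 \<le> geom_ent_pure \<phi>" "geom_ent_pure \<phi> \<le> 1"
  using max_overlap_le[of \<phi>] max_overlap_nonneg[of \<phi>] assms by (simp_all add: geom_ent_pure_eq)

text \<open>Overlaps of unit vectors lie between 0 and 1, so the weights \<open>p\<close> dominate
  both averages, which add up to the total weight 1.\<close>

lemma pure_decomposition_sums:
  assumes "pure_decomposition \<rho> p \<phi>"
  shows "summable (\<lambda>k. p k * max_overlap (\<phi> k))"
    "(\<Sum>k. p k * geom_ent_pure (\<phi> k)) = 1 - (\<Sum>k. p k * max_overlap (\<phi> k))"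
    "0 \<le> (\<Sum>k. p k * geom_ent_pure (\<phi> k))"
proof -
  have p: "p sums 1" "\<And>k. 0 \<le> p k" and \<phi>: "\<And>k. norm (\<phi> k) = 1"
    using assms by (auto simp: pure_decomposition_def)
  show s: "summable (\<lambda>k. p k * max_overlap (\<phi> k))"
  proof (rule summable_comparison_test'[OF sums_summable[OF p(1)]])
    show "norm (p k * max_overlap (\<phi> k)) \<le> p k" for k
      using max_overlap_le[of "\<phi> k"] max_overlap_nonneg[of "\<phi> k"] p(2)[of k]
      by (simp add: \<phi> abs_mult mult_left_le)
  qed
  have *: "(\<lambda>k. p k * geom_ent_pure (\<phi> k)) sums (1 - (\<Sum>k. p k * max_overlap (\<phi> k)))"
    using sums_diff[OF p(1) summable_sums[OF s]] by (simp add: geom_ent_pure_eq algebra_simps)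
  then show "(\<Sum>k. p k * geom_ent_pure (\<phi> k)) = 1 - (\<Sum>k. p k * max_overlap (\<phi> k))"
    by (rule sums_unique[symmetric])
  show "0 \<le> (\<Sum>k. p k * geom_ent_pure (\<phi> k))"
    using * p(2) geom_ent_pure_bounds(1)[OF \<phi>] by (intro suminf_nonneg) (auto intro: sums_summable)
qed

text \<open>Factorizing each \<open>M\<^sub>i = \<Sum>\<^sub>j |m\<^sub>i\<^sub>j\<rangle>\<langle>m\<^sub>i\<^sub>j|\<close> refines the measurement on \<open>A\<close> to a rank-one one, which
  steers \<open>BC\<close> to the pure decomposition with the vectors \<open>(\<langle>m\<^sub>i\<^sub>j| \<otimes> 1) \<psi>\<close>.\<close>

lemma povm_imp_pure_decomposition:
  fixes \<psi> :: "('a \<times> 'b \<times> 'c) ell2"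
  assumes M: "povm M" and \<mu>: "\<And>i. density_op (\<mu> i)" and \<psi>: "norm \<psi> = 1"
  obtains p \<phi> where "pure_decomposition (reduced_BC \<psi>) p \<phi>"
    "summable (\<lambda>i. Re (trace ((M i \<otimes>\<^sub>o \<mu> i) \<circ> reduced_AB \<psi>)))"
    "(\<Sum>i. Re (trace ((M i \<otimes>\<^sub>o \<mu> i) \<circ> reduced_AB \<psi>))) \<le> 1 - (\<Sum>k. p k * geom_ent_pure (\<phi> k))"
proof -
  have posM: "positive_op (M i)" and sumM: "(\<lambda>i. M i x) sums x" for i x
    using M by (auto simp: povm_def)
  have pos\<mu>: "positive_op (\<mu> i)" for i using \<mu> by (simp add: density_op_def)
  \<comment> \<open>The vectors of \<open>A\<close> obtained from \<open>\<psi>\<close> by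
    contracting \<open>BC\<close> vanish outside \<open>I\<close>, hence one enumeration is enough
    for all outcomes.\<close>
  define I where "I = fst ` {i. coord \<psi> i \<noteq> 0}"
  have "countable I" unfolding I_def using countable_support by (rule countable_image)
  then obtain e :: "nat \<Rightarrow> 'a ell2" where e: "ket ` I \<subseteq> range e" by (rule enumerate_kets)
  have I: "coord \<psi> (a, d) = 0" if "a \<notin> I" for a d
    using that unfolding I_def by force
  define m where "m i j = chol_vec (M i) e j" for i j
  define f where "f i j = left_bra (m i j) \<psi>" for i j
  define t where "t i = Re (trace ((M i \<otimes>\<^sub>o \<mu> i) \<circ> reduced_AB \<psi>))" for i
  define w where "w i j = (norm (f i j))\<^sup>2 * max_overlap (normalized (f i j))" for i j
  \<comment> \<open>The sum over \<open>j\<close> gives the form of \<open>M i\<close> by Cholesky,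
    and the sum over \<open>i\<close> gives the identity by completeness of the measurement.\<close>
  have parseval: "((\<lambda>(i, j). (cmod (cinner (m i j) x))\<^sup>2) has_sum (norm x)\<^sup>2) UNIV"
    if x: "\<And>a. a \<notin> I \<Longrightarrow> coord x a = 0" for x
  proof (rule has_sum_iterated_nonneg)
    show "((\<lambda>j. (cmod (cinner (m i j) x))\<^sup>2) has_sum Re (cinner x (M i x))) UNIV" for i
      unfolding m_def using chol_form_sums[OF posM e x] by (simp add: sums_nonneg_has_sum_iff)
    have "(\<lambda>i. Re (cinner x (M i x))) sums Re (cinner x x)"
      by (intro sums_Re bounded_linear.sums[OF cinner.bounded_linear_right sumM])
    then show "((\<lambda>i. Re (cinner x (M i x))) has_sum (norm x)\<^sup>2) UNIV"
      using positive_op_cinner(1)[OF posM]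
      by (simp add: sums_nonneg_has_sum_iff cinner_self_norm del: of_real_power)
  qed simp
  have form: "((\<lambda>(i, j). (cmod (cinner (f i j) y))\<^sup>2) has_sum Re (cinner y (reduced_BC \<psi> y))) UNIV" for y
  proof -
    have "cmod (cinner (m i j) (right_bra y \<psi>)) = cmod (cinner (f i j) y)" for i j
      unfolding f_def by (metis cinner_commute cinner_tensor_left_bra cinner_tensor_right_bra complex_mod_cnj)
    moreover have "coord (right_bra y \<psi>) a = 0" if "a \<notin> I" for a
    proof -
      have "bra_fst a \<psi> = 0" by (rule ell2_eqI) (simp add: I that)
      then show ?thesis by simp
    qed
    ultimately show ?thesis
      using parseval[of "right_bra y \<psi>"] by (simp add: reduced_BC_form)
  qed
  have norm_f: "((\<lambda>(i, j). (norm (f i j))\<^sup>2) has_sum 1) UNIV"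
  proof -
    \<comment> \<open>Parseval is applied to each slice of \<open>\<psi>\<close> at a basis index
      \<open>d\<close> of \<open>BC\<close>. Packing outcome and factor into one index
      \<open>ij\<close> allows the exchange with the sum over \<open>d\<close>.\<close>
    have "((\<lambda>ij. (norm (f (fst ij) (snd ij)))\<^sup>2) has_sum 1) UNIV
        \<longleftrightarrow> ((\<lambda>d. (norm (bra_snd d \<psi>))\<^sup>2) has_sum 1) UNIV"
    proof (rule has_sum_swap_nonneg)
      show "((\<lambda>d. (cmod (cinner (m (fst ij) (snd ij)) (bra_snd d \<psi>)))\<^sup>2) has_sum
          (norm (f (fst ij) (snd ij)))\<^sup>2) UNIV" for ij
        unfolding f_def by (rule norm_left_bra_has_sum)
      show "((\<lambda>ij. (cmod (cinner (m (fst ij) (snd ij)) (bra_snd d \<psi>)))\<^sup>2) has_sum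
          (norm (bra_snd d \<psi>))\<^sup>2) UNIV" for d
        using parseval[of "bra_snd d \<psi>"] I by (simp add: case_prod_unfold)
    qed simp
    then show ?thesis using norm_bra_snd_has_sum[of \<psi>] \<psi> by (simp add: case_prod_unfold)
  qed
  have w_nonneg: "0 \<le> w i j" for i j
    by (simp add: w_def max_overlap_nonneg)
  have "(\<lambda>(i, j). w i j) summable_on UNIV"
  proof (rule summable_on_comparison_test[OF has_sum_imp_summable[OF norm_f]])
    fix ij :: "nat \<times> nat"
    show "(case ij of (i, j) \<Rightarrow> w i j) \<le> (case ij of (i, j) \<Rightarrow> (norm (f i j))\<^sup>2)"
      using max_overlap_le[of "normalized (f (fst ij) (snd ij))"]
      by (simp add: w_def case_prod_unfold mult_left_le)
  qed (auto simp: w_nonneg)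
  then obtain W where W: "((\<lambda>(i, j). w i j) has_sum W) UNIV"
    unfolding summable_on_def by blast
  have "(\<lambda>j. w i j) summable_on UNIV" for i
    using has_sum_imp_summable[OF W] w_nonneg
    by (intro summable_on_SigmaD1[where f = w and A = UNIV and B = "\<lambda>_. UNIV"]) simp_all
  then have w: "((\<lambda>j. w i j) has_sum (\<Sum>\<^sub>\<infinity>j. w i j)) UNIV" for i
    by (rule has_sum_infsum)
  have "((\<lambda>i. \<Sum>\<^sub>\<infinity>j. w i j) has_sum W) UNIV"
    using has_sum_prod_nonneg_iff[where f = w and g = "\<lambda>i. \<Sum>\<^sub>\<infinity>j. w i j", OF w_nonneg w] W by simp
  then have w_sums: "(\<lambda>i. \<Sum>\<^sub>\<infinity>j. w i j) sums W"
    by (rule has_sum_imp_sums)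
  \<comment> \<open>The trace is a double sum of \<open>q c j\<close> over slices of
    \<open>C\<close> and Cholesky factors: over \<open>j\<close> first it is the form of
    \<open>M i \<otimes>\<^sub>o \<mu> i\<close>, over \<open>c\<close> first its terms are at most
    \<open>w i j\<close>.\<close>
  have t: "0 \<le> t i \<and> t i \<le> (\<Sum>\<^sub>\<infinity>j. w i j)" for i
  proof -
    define v where "v c = bra_snd c (assoc_ell2 \<psi>)" for c
    define q where "q c j = Re (cinner (bra_snd c (f i j)) (\<mu> i (bra_snd c (f i j))))" for c j
    have q_nonneg: "0 \<le> q c j" for c j
      unfolding q_def by (rule positive_op_cinner[OF pos\<mu>])
    have "\<exists>s. ((\<lambda>c. q c j) has_sum s) UNIV \<and> s \<le> w i j" for j
      unfolding q_def w_def using density_overlap_scaled[OF \<mu>, of "f i j" i] by metis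
    then obtain s where s: "\<And>j. ((\<lambda>c. q c j) has_sum s j) UNIV" "\<And>j. s j \<le> w i j"
      by metis
    have s_nonneg: "0 \<le> s j" for j
      using s(1) by (rule has_sum_nonneg) (rule q_nonneg)
    have s_summable: "s summable_on UNIV"
      by (rule summable_on_comparison_test[OF has_sum_imp_summable[OF w]]) (rule s s_nonneg)+
    have inner: "((\<lambda>j. q c j) has_sum Re (cinner (v c) ((M i \<otimes>\<^sub>o \<mu> i) (v c)))) UNIV" for c
    proof -
      have "coord (v c) (a, b) = 0" if "a \<notin> I" for a b
        by (simp add: v_def I that)
      from sums_Re[OF tensor_op_form_sums[OF posM pos\<mu> e this, of i i]]
      have "(\<lambda>j. q c j) sums Re (cinner (v c) ((M i \<otimes>\<^sub>o \<mu> i) (v c)))"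
        by (simp add: q_def f_def m_def v_def left_bra_assoc)
      then show ?thesis by (simp add: sums_nonneg_has_sum_iff q_nonneg)
    qed
    have "(s has_sum infsum s UNIV) UNIV
        \<longleftrightarrow> ((\<lambda>c. Re (cinner (v c) ((M i \<otimes>\<^sub>o \<mu> i) (v c)))) has_sum infsum s UNIV) UNIV"
      by (rule has_sum_swap_nonneg[where f = "\<lambda>j c. q c j"]) (rule q_nonneg s inner)+
    then have "((\<lambda>c. Re (cinner (v c) ((M i \<otimes>\<^sub>o \<mu> i) (v c)))) has_sum infsum s UNIV) UNIV"
      using has_sum_infsum[OF s_summable] by blast
    moreover have "((\<lambda>c. Re (cinner (v c) ((M i \<otimes>\<^sub>o \<mu> i) (v c)))) has_sum t i) UNIV"
      unfolding v_def t_def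
      by (intro trace_reduced_AB bounded_clinear_tensor_op positive_op_bounded posM pos\<mu>)
    ultimately have "t i = infsum s UNIV" using has_sum_unique by blast
    moreover have "infsum s UNIV \<le> (\<Sum>\<^sub>\<infinity>j. w i j)"
      by (intro infsum_mono s_summable has_sum_imp_summable[OF w] s)
    ultimately show ?thesis using infsum_nonneg[of UNIV s] s_nonneg by simp
  qed
  have t_summable: "summable t"
    by (rule summable_comparison_test'[OF sums_summable[OF w_sums]]) (use t in auto)
  have t_le: "suminf t \<le> W"
    using suminf_le[OF _ t_summable sums_summable[OF w_sums]] t sums_unique[OF w_sums] by auto
  \<comment> \<open>Pairs of outcome and factor are renumbered, since ensembles are indexed by
    natural numbers.\<close>
  define F where "F k = (case prod_decode k of (i, j) \<Rightarrow> f i j)" for k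
  have reindex: "((\<lambda>k. h (F k)) has_sum S) UNIV \<longleftrightarrow> ((\<lambda>(i, j). h (f i j)) has_sum S) UNIV"
    for h :: "('b \<times> 'c) ell2 \<Rightarrow> real" and S
    using has_sum_reindex_bij_betw[OF bij_prod_decode, of "\<lambda>(i, j). h (f i j)" S]
    by (simp add: F_def case_prod_unfold)
  have decomp: "pure_decomposition (reduced_BC \<psi>) (\<lambda>k. (norm (F k))\<^sup>2) (\<lambda>k. normalized (F k))"
    unfolding pure_decomposition_def proj_normalized
  proof (intro conjI allI)
    show "(\<lambda>k. (norm (F k))\<^sup>2) sums 1"
      using norm_f reindex[of "\<lambda>g. (norm g)\<^sup>2"] by (intro has_sum_imp_sums) simp
    have "(\<lambda>k. (cmod (cinner (F k) y))\<^sup>2) sums Re (cinner y (reduced_BC \<psi> y))" for y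
      using form[of y] reindex[of "\<lambda>g. (cmod (cinner g y))\<^sup>2"] by (intro has_sum_imp_sums) simp
    then show "(\<lambda>k. proj (F k) x) sums reduced_BC \<psi> x" for x
      by (rule positive_op_sums_proj[OF positive_op_reduced_BC])
  qed simp_all
  have "(\<lambda>k. (norm (F k))\<^sup>2 * max_overlap (normalized (F k))) sums W"
    using W reindex[of "\<lambda>g. (norm g)\<^sup>2 * max_overlap (normalized g)"]
    by (intro has_sum_imp_sums) (simp add: w_def)
  then have "suminf t \<le> 1 - (\<Sum>k. (norm (F k))\<^sup>2 * geom_ent_pure (normalized (F k)))"
    using t_le pure_decomposition_sums(2)[OF decomp] by (simp add: sums_iff)
  then show ?thesis
    using that[OF decomp] t_summable unfolding t_def by blast
qed

section \<open>From decompositions to measurements\<close>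

text \<open>Riesz representation on the (not necessarily closed) range of \<open>L\<close>: minimize
  \<open>\<parallel>L y\<parallel>\<^sup>2 - 2 f y\<close>.\<close>

lemma Riesz_range:
  fixes L :: "'x :: real_vector \<Rightarrow> 'h :: {real_inner, banach}" and f :: "'x \<Rightarrow> real"
  assumes L: "linear L" and f: "linear f" and le: "\<And>y. \<bar>f y\<bar> \<le> norm (L y)"
  obtains m Y where "\<And>z. inner m (L z) = f z" "(\<lambda>n. L (Y n)) \<longlonglongrightarrow> m"
proof -
  note L_simps = linear_add[OF L] linear_diff[OF L] linear_scale[OF L]
    and f_simps = linear_add[OF f] linear_diff[OF f] linear_scale[OF f]
  define J where "J y = (norm (L y))\<^sup>2 - 2 * f y" for y
  \<comment> \<open>The domination of \<open>f\<close> makes J at least r^2 - 2 r with r =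
    \<open>norm (L y)\<close>.\<close>
  have "- 1 \<le> J y" for y
    using le[of y] sum_squares_bound[of "norm (L y)" 1] by (simp add: J_def)
  then have bdd: "bdd_below (range J)" by (auto intro!: bdd_belowI)
  define d where "d = Inf (range J)"
  have d: "d \<le> J y" for y unfolding d_def by (rule cInf_lower[OF _ bdd]) simp
  have "\<exists>y. J y < d + inverse (real (Suc n))" for n
    using cInf_less_iff[OF _ bdd, of "d + inverse (real (Suc n))"] by (auto simp: d_def)
  then obtain Y where Y: "\<And>n. J (Y n) < d + inverse (real (Suc n))" by metis
  \<comment> \<open>Parallelogram law at the midpoint, where J is still at least \<open>d\<close>;
    it makes every minimizing sequence Cauchy in the range.\<close>
  have diff: "(norm (L u - L v))\<^sup>2 \<le> 2 * (J u - d) + 2 * (J v - d)" for u v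
  proof -
    have "4 * J ((1 / 2) *\<^sub>R (u + v)) = (norm (L u + L v))\<^sup>2 - 4 * (f u + f v)"
      by (simp add: J_def L_simps f_simps power_divide add_divide_distrib flip: scaleR_add_right)
    moreover have "(norm (L u - L v))\<^sup>2 + (norm (L u + L v))\<^sup>2 = 2 * (norm (L u))\<^sup>2 + 2 * (norm (L v))\<^sup>2"
      by (simp add: power2_norm_eq_inner inner_add_left inner_add_right inner_diff_left inner_diff_right)
    ultimately show ?thesis using d[of "(1 / 2) *\<^sub>R (u + v)"] by (simp add: J_def)
  qed
  have "Cauchy (\<lambda>n. L (Y n))"
  proof (rule metric_CauchyI)
    fix e :: real assume "0 < e"
    then obtain N where N: "inverse (real (Suc N)) < e\<^sup>2 / 4"
      using reals_Archimedean[of "e\<^sup>2 / 4"] by auto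
    have small: "J (Y n) - d < e\<^sup>2 / 4" if "n \<ge> N" for n
    proof -
      have "inverse (real (Suc n)) \<le> inverse (real (Suc N))" using that by simp
      then show ?thesis using Y[of n] N by linarith
    qed
    have "dist (L (Y n)) (L (Y k)) < e" if "n \<ge> N" "k \<ge> N" for n k
    proof (rule power2_less_imp_less)
      show "(dist (L (Y n)) (L (Y k)))\<^sup>2 < e\<^sup>2"
        using diff[of "Y n" "Y k"] small[OF that(1)] small[OF that(2)]
        unfolding dist_norm by argo
    qed (use \<open>0 < e\<close> in simp)
    then show "\<exists>N. \<forall>n\<ge>N. \<forall>k\<ge>N. dist (L (Y n)) (L (Y k)) < e" by blast
  qed
  then obtain m where m: "(\<lambda>n. L (Y n)) \<longlonglongrightarrow> m"
    using Cauchy_convergent convergent_def by blast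
  have J_lim: "(\<lambda>n. J (Y n)) \<longlonglongrightarrow> d"
  proof (rule tendsto_sandwich[OF _ _ tendsto_const])
    show "(\<lambda>n. d + inverse (real (Suc n))) \<longlonglongrightarrow> d"
      using tendsto_add[OF tendsto_const LIMSEQ_inverse_real_of_nat, of d] by simp
  qed (use d Y in \<open>auto simp: less_imp_le\<close>)
  have "inner m (L z) = f z" for z
  proof -
    define c where "c = inner m (L z) - f z"
    \<comment> \<open>The limit of the minimality condition along
      \<open>Y n + t *\<^sub>R z\<close>. A minimizer in the domain need not exist, so the variation
      is taken before passing to the limit.\<close>
    have var: "0 \<le> 2 * t * c + t\<^sup>2 * (norm (L z))\<^sup>2" for t
    proof -
      have "d \<le> J (Y n) + 2 * t * (inner (L (Y n)) (L z) - f z) + t\<^sup>2 * (norm (L z))\<^sup>2" for n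
      proof -
        have "J (Y n + t *\<^sub>R z) = J (Y n) + 2 * t * (inner (L (Y n)) (L z) - f z) + t\<^sup>2 * (norm (L z))\<^sup>2"
          by (simp add: J_def L_simps f_simps power2_norm_eq_inner inner_left_distrib inner_right_distrib
              inner_commute power2_eq_square[of t] algebra_simps)
        then show ?thesis using d[of "Y n + t *\<^sub>R z"] by simp
      qed
      moreover have "(\<lambda>n. J (Y n) + 2 * t * (inner (L (Y n)) (L z) - f z) + t\<^sup>2 * (norm (L z))\<^sup>2)
          \<longlonglongrightarrow> d + 2 * t * (inner m (L z) - f z) + t\<^sup>2 * (norm (L z))\<^sup>2"
        by (intro tendsto_intros J_lim m)
      ultimately have "d \<le> d + 2 * t * (inner m (L z) - f z) + t\<^sup>2 * (norm (L z))\<^sup>2"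
        by (intro LIMSEQ_le_const) auto
      then show ?thesis by (simp add: c_def)
    qed
    \<comment> \<open>The summand 1 avoids a division by zero when \<open>L z = 0\<close>; with t =
      -c/B the condition becomes a negative multiple of c^2.\<close>
    define B where "B = (norm (L z))\<^sup>2 + 1"
    have B: "0 < B" "(norm (L z))\<^sup>2 = B - 1" by (simp_all add: B_def add_nonneg_pos)
    have "0 \<le> B\<^sup>2 * (2 * (- c / B) * c + (- c / B)\<^sup>2 * (B - 1))"
      using var[of "- c / B"] B by (intro mult_nonneg_nonneg) auto
    also have "\<dots> = - (c\<^sup>2 * (B + 1))"
      using B(1) by (simp add: power2_eq_square field_simps)
    finally have "c\<^sup>2 * (B + 1) \<le> 0" by simp
    then have "c = 0" using B(1) by (simp add: mult_le_0_iff)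
    then show ?thesis by (simp add: c_def)
  qed
  then show ?thesis using that m by blast
qed

lemma right_bra_scaleR: "right_bra (r *\<^sub>R y) x = r *\<^sub>R right_bra y x"
  using right_bra_scaleC[of "of_real r" y x] by (simp add: scaleC_of_real)

text \<open>Riesz representation of the real part of <y|f>, with the imaginary part recovered from
  \<i> y. The approximating \<open>Y\<close> is kept because Bessel's inequality depends on
  \<open>m\<close> lying in the closure of the range.\<close>

lemma steering_vector:
  assumes le: "\<And>y. cmod (cinner y f) \<le> norm (right_bra y \<psi>)"
  obtains m Y where "left_bra m \<psi> = f" "(\<lambda>n. right_bra (Y n) \<psi>) \<longlonglongrightarrow> m"
proof -
  have "linear (\<lambda>y. right_bra y \<psi>)"
    by (rule linearI) (simp_all add: right_bra_add right_bra_scaleR)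
  moreover have "linear (\<lambda>y. Re (cinner y f))"
    by (rule linearI) (simp_all add: cinner_add_left cinner.scaleR_left)
  moreover have "\<bar>Re (cinner y f)\<bar> \<le> norm (right_bra y \<psi>)" for y
    using le abs_Re_le_cmod order_trans by blast
  ultimately obtain m Y where m: "\<And>z. inner m (right_bra z \<psi>) = Re (cinner z f)"
    and Y: "(\<lambda>n. right_bra (Y n) \<psi>) \<longlonglongrightarrow> m"
    using Riesz_range[of "\<lambda>y. right_bra y \<psi>" "\<lambda>y. Re (cinner y f)"] by metis
  have Re: "Re (cinner z (left_bra m \<psi>)) = Re (cinner z f)" for z
    using m[of z] by (metis Re_cinner cinner_tensor_left_bra cinner_tensor_right_bra)
  have "left_bra m \<psi> = f"
  proof (rule cinner_eqI)
    show "cinner z (left_bra m \<psi>) = cinner z f" for z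
      using Re[of z] Re[of "\<i> *\<^sub>C z"] by (simp add: complex_eq_iff)
  qed
  then show ?thesis using that Y by blast
qed

lemma cinner_sum_proj:
  "cinner x (\<Sum>i\<in>F. proj (m i) x) = of_real (\<Sum>i\<in>F. (cmod (cinner (m i) x))\<^sup>2)"
  by (simp add: cinner.sum_right cinner_proj)

text \<open>Bessel's inequality for \<open>m\<close> on a subspace implies it everywhere, if all \<open>m i\<close> lie in the closure
  of the subspace.\<close>

lemma Bessel_from_range:
  assumes F: "finite F" and lim: "\<And>i. (\<lambda>n. right_bra (Y i n) \<psi>) \<longlonglongrightarrow> m i"
    and bessel: "\<And>y. (\<Sum>i\<in>F. (cmod (cinner (m i) (right_bra y \<psi>)))\<^sup>2) \<le> (norm (right_bra y \<psi>))\<^sup>2"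
  shows "(norm (\<Sum>i\<in>F. proj (m i) x))\<^sup>2 \<le> (\<Sum>i\<in>F. (cmod (cinner (m i) x))\<^sup>2)"
    and "(\<Sum>i\<in>F. (cmod (cinner (m i) x))\<^sup>2) \<le> (norm x)\<^sup>2"
proof -
  define w where "w = (\<Sum>i\<in>F. proj (m i) x)"
  define q where "q = (\<Sum>i\<in>F. (cmod (cinner (m i) x))\<^sup>2)"
  \<comment> \<open>The conjugate compensates the antilinearity of \<open>right_bra\<close> in its
    first argument, so that the images converge to \<open>w\<close>.\<close>
  define y where "y n = (\<Sum>i\<in>F. cnj (cinner (m i) x) *\<^sub>C Y i n)" for n
  have y: "right_bra (y n) \<psi> = (\<Sum>i\<in>F. cinner (m i) x *\<^sub>C right_bra (Y i n) \<psi>)" for n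
    by (rule ell2_eqI) (simp add: y_def coord_sum cinner.sum_left)
  have yw: "(\<lambda>n. right_bra (y n) \<psi>) \<longlonglongrightarrow> w"
    unfolding y w_def proj_def by (intro tendsto_sum scaleC.tendsto tendsto_const lim)
  have "(\<Sum>i\<in>F. (cmod (cinner (m i) w))\<^sup>2) \<le> (norm w)\<^sup>2"
  proof (rule LIMSEQ_le)
    show "(\<lambda>n. \<Sum>i\<in>F. (cmod (cinner (m i) (right_bra (y n) \<psi>)))\<^sup>2) \<longlonglongrightarrow> (\<Sum>i\<in>F. (cmod (cinner (m i) w))\<^sup>2)"
      by (intro tendsto_intros cinner.tendsto yw)
    show "(\<lambda>n. (norm (right_bra (y n) \<psi>))\<^sup>2) \<longlonglongrightarrow> (norm w)\<^sup>2"
      by (intro tendsto_intros yw)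
  qed (use bessel in auto)
  \<comment> \<open>Expanding <w|w> in the \<open>m i\<close> and using 2ab \<le> a^2 + b^2 leaves
    Bessel's sum at \<open>w\<close>, already known to be at most the squared norm of
    \<open>w\<close>.\<close>
  moreover have "2 * (norm w)\<^sup>2 \<le> q + (\<Sum>i\<in>F. (cmod (cinner (m i) w))\<^sup>2)"
  proof -
    have "complex_of_real ((norm w)\<^sup>2) = (\<Sum>i\<in>F. cinner (m i) x * cinner w (m i))"
      unfolding cinner_self_norm[symmetric]
      by (subst (2) w_def) (simp add: cinner.sum_right proj_def)
    then have "(norm w)\<^sup>2 = (\<Sum>i\<in>F. Re (cinner (m i) x * cinner w (m i)))"
      by (metis Re_complex_of_real Re_sum)
    then have "2 * (norm w)\<^sup>2 = (\<Sum>i\<in>F. 2 * Re (cinner (m i) x * cinner w (m i)))"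
      by (simp add: sum_distrib_left)
    also have "\<dots> \<le> (\<Sum>i\<in>F. (cmod (cinner (m i) x))\<^sup>2 + (cmod (cinner (m i) w))\<^sup>2)"
    proof (rule sum_mono)
      fix i
      have "Re (cinner (m i) x * cinner w (m i)) \<le> cmod (cinner (m i) x) * cmod (cinner (m i) w)"
        by (metis cinner_commute complex_Re_le_cmod complex_mod_cnj norm_mult)
      then show "2 * Re (cinner (m i) x * cinner w (m i)) \<le> (cmod (cinner (m i) x))\<^sup>2 + (cmod (cinner (m i) w))\<^sup>2"
        using sum_squares_bound[of "cmod (cinner (m i) x)" "cmod (cinner (m i) w)"] by linarith
    qed
    finally show ?thesis by (simp add: q_def sum.distrib)
  qed
  ultimately have wq: "(norm w)\<^sup>2 \<le> q" by simp
  then show "(norm (\<Sum>i\<in>F. proj (m i) x))\<^sup>2 \<le> (\<Sum>i\<in>F. (cmod (cinner (m i) x))\<^sup>2)"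
    by (simp add: w_def q_def)
  \<comment> \<open>With the bound just found this reads q \<le> norm x * sqrt q, from which q can
    be cancelled.\<close>
  have "q = Re (cinner x w)"
    unfolding w_def cinner_sum_proj by (simp add: q_def)
  also have "\<dots> \<le> norm x * norm w"
    using complex_Re_le_cmod norm_cinner_le order_trans by blast
  finally show "(\<Sum>i\<in>F. (cmod (cinner (m i) x))\<^sup>2) \<le> (norm x)\<^sup>2"
    using sum_squares_bound[of "norm x" "norm w"] wq unfolding q_def by linarith
qed

text \<open>The first hypothesis says G^2 \<le> G for the finite sums G of projections; it lets the
  Cauchy criterion of the scalar series pass to the operator series. The second makes the complement
  positive.\<close>

lemma povm_completion:
  assumes norm_le: "\<And>F x. finite F \<Longrightarrow> (norm (\<Sum>i\<in>F. proj (m i) x))\<^sup>2 \<le> (\<Sum>i\<in>F. (cmod (cinner (m i) x))\<^sup>2)"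
    and bessel: "\<And>F x. finite F \<Longrightarrow> (\<Sum>i\<in>F. (cmod (cinner (m i) x))\<^sup>2) \<le> (norm x)\<^sup>2"
  obtains M where "povm M" "\<And>i. M (Suc i) = proj (m i)"
proof -
  have q: "summable (\<lambda>i. (cmod (cinner (m i) x))\<^sup>2)" for x
    by (rule summableI_nonneg_bounded[where x = "(norm x)\<^sup>2"]) (use bessel in auto)
  have "summable (\<lambda>i. proj (m i) x)" for x
    unfolding summable_Cauchy
  proof (intro allI impI)
    fix e :: real assume "0 < e"
    then have "0 < e\<^sup>2" by simp
    then obtain N where N: "\<And>k n. k \<ge> N \<Longrightarrow> norm (\<Sum>i\<in>{k..<n}. (cmod (cinner (m i) x))\<^sup>2) < e\<^sup>2"
      using q[of x, unfolded summable_Cauchy] by blast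
    have "norm (\<Sum>i\<in>{k..<n}. proj (m i) x) < e" if "k \<ge> N" for k n
    proof (rule power2_less_imp_less)
      show "(norm (\<Sum>i\<in>{k..<n}. proj (m i) x))\<^sup>2 < e\<^sup>2"
        using norm_le[of "{k..<n}" x] N[OF that, of n] by simp
    qed (use \<open>0 < e\<close> in simp)
    then show "\<exists>N. \<forall>k\<ge>N. \<forall>n. norm (\<Sum>i\<in>{k..<n}. proj (m i) x) < e" by blast
  qed
  then have S: "(\<lambda>i. proj (m i) x) sums (\<Sum>i. proj (m i) x)" for x
    by (rule summable_sums)
  define S where "S x = (\<Sum>i. proj (m i) x)" for x
  note S = S[folded S_def]
  note simps = bounded_clinear_simps[OF bounded_clinear_proj]
  have lin: "bounded_clinear S"
  proof (rule bounded_clinearI)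
    show "S (x + y) = S x + S y" for x y
      using sums_add[OF S[of x] S[of y]] S[of "x + y"] by (simp add: simps(1) sums_unique2)
    show "S (c *\<^sub>C x) = c *\<^sub>C S x" for c x
      using bounded_linear.sums[OF scaleC.bounded_linear_right S[of x], of c] S[of "c *\<^sub>C x"]
      by (simp add: simps(4) sums_unique2)
    show "norm (S x) \<le> 1 * norm x" for x
    proof (rule LIMSEQ_le_const2)
      show "(\<lambda>n. norm (\<Sum>i<n. proj (m i) x)) \<longlonglongrightarrow> norm (S x)"
        using S[of x] unfolding sums_def by (rule tendsto_norm)
      have "norm (\<Sum>i<n. proj (m i) x) \<le> norm x" for n
        by (rule power2_le_imp_le[OF order_trans[OF norm_le bessel]]) auto
      then show "\<exists>N. \<forall>n\<ge>N. norm (\<Sum>i<n. proj (m i) x) \<le> 1 * norm x" by simp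
    qed
  qed
  have id: "bounded_clinear (\<lambda>x :: 'a ell2. x)"
    by (rule bounded_clinearI[where K = 1]) auto
  have pos: "positive_op (\<lambda>x. x - S x)"
  proof (rule positive_opI[OF bounded_clinear_diff[OF id lin]])
    show "cinner x (x - S x) = of_real ((norm x)\<^sup>2 - (\<Sum>i. (cmod (cinner (m i) x))\<^sup>2))" for x
    proof -
      have "(\<lambda>i. cinner x (proj (m i) x)) sums cinner x (S x)"
        by (rule bounded_linear.sums[OF cinner.bounded_linear_right S])
      then have "(\<lambda>i. complex_of_real ((cmod (cinner (m i) x))\<^sup>2)) sums cinner x (S x)"
        unfolding cinner_proj .
      moreover have "(\<lambda>i. complex_of_real ((cmod (cinner (m i) x))\<^sup>2)) sums of_real (\<Sum>i. (cmod (cinner (m i) x))\<^sup>2)"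
        by (rule sums_of_real[OF summable_sums[OF q]])
      ultimately have "cinner x (S x) = of_real (\<Sum>i. (cmod (cinner (m i) x))\<^sup>2)"
        by (rule sums_unique2)
      then show ?thesis by (simp only: cinner.diff_right cinner_self_norm of_real_diff)
    qed
    show "0 \<le> (norm x)\<^sup>2 - (\<Sum>i. (cmod (cinner (m i) x))\<^sup>2)" for x
      using suminf_le_const[OF q bessel, of x] by simp
  qed
  \<comment> \<open>Outcome 0 is reserved for the complement, so the given vectors move up by
    one.\<close>
  define M where "M i = (case i of 0 \<Rightarrow> (\<lambda>x. x - S x) | Suc j \<Rightarrow> proj (m j))" for i
  have "povm M"
    unfolding povm_def
  proof (intro conjI allI)
    show "positive_op (M i)" for i
      by (cases i) (simp_all add: M_def pos positive_op_proj)
    have "(\<lambda>i. M (Suc i) x) sums S x" for x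
      using S[of x] by (simp add: M_def)
    then show "(\<lambda>i. M i x) sums x" for x
      using sums_Suc_iff[of "\<lambda>i. M i x" "S x"] by (simp add: M_def)
  qed
  then show ?thesis using that by (simp add: M_def)
qed

section \<open>Fidelity reached by steering to a given ensemble\<close>

lemma density_op_proj:
  assumes "norm \<phi> = 1"
  shows "density_op (proj \<phi>)"
proof -
  have "((\<lambda>i. complex_of_real ((cmod (coord \<phi> i))\<^sup>2)) has_sum of_real ((norm \<phi>)\<^sup>2)) UNIV"
    by (rule has_sum_of_real[OF norm_sq_has_sum])
  then show ?thesis
    using assms unfolding density_op_def cinner_proj
    by (simp add: positive_op_proj)
qed

lemma trace_proj_proj:
  "Re (trace ((proj m \<otimes>\<^sub>o proj \<xi>) \<circ> reduced_AB \<psi>)) = (norm (left_bra \<xi> (left_bra m \<psi>)))\<^sup>2"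
proof -
  have "((\<lambda>c. Re (cinner (bra_snd c (assoc_ell2 \<psi>)) ((proj m \<otimes>\<^sub>o proj \<xi>) (bra_snd c (assoc_ell2 \<psi>))))) has_sum
      Re (trace ((proj m \<otimes>\<^sub>o proj \<xi>) \<circ> reduced_AB \<psi>))) UNIV"
    by (intro trace_reduced_AB bounded_clinear_tensor_op bounded_clinear_proj)
  then have "((\<lambda>c. (cmod (cinner \<xi> (bra_snd c (left_bra m \<psi>))))\<^sup>2) has_sum
      Re (trace ((proj m \<otimes>\<^sub>o proj \<xi>) \<circ> reduced_AB \<psi>))) UNIV"
    by (simp add: tensor_op_proj_form bounded_clinear_proj cinner_proj left_bra_assoc)
  then show ?thesis using norm_left_bra_has_sum has_sum_unique by blast
qed

lemma trace_reduced_AB_nonneg: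
  assumes "positive_op M" "positive_op N"
  shows "0 \<le> Re (trace ((M \<otimes>\<^sub>o N) \<circ> reduced_AB \<psi>))"
  using trace_reduced_AB[OF bounded_clinear_tensor_op, OF assms[THEN positive_op_bounded]]
  by (rule has_sum_nonneg) (rule tensor_op_form_nonneg[OF assms])

text \<open>Absorbing the probabilities as square roots into the \<open>f k\<close> gives the
  conditional vectors to be steered to. For each outcome Bob then prepares a nearly optimal product
  factor of \<open>\<phi> k\<close>.\<close>

lemma pure_decomposition_imp_povm:
  fixes \<psi> :: "('a \<times> 'b \<times> 'c) ell2"
  assumes dec: "pure_decomposition (reduced_BC \<psi>) p \<phi>" and \<psi>: "norm \<psi> = 1" and "0 < \<epsilon>"
  obtains M \<mu> where "povm M" "\<And>i. density_op (\<mu> i)"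
    "1 - (\<Sum>k. p k * geom_ent_pure (\<phi> k)) - \<epsilon> \<le> (\<Sum>i. Re (trace ((M i \<otimes>\<^sub>o \<mu> i) \<circ> reduced_AB \<psi>)))"
proof -
  have p: "p sums 1" "\<And>k. 0 \<le> p k" and \<phi>: "\<And>k. norm (\<phi> k) = 1"
    and sums: "\<And>x. (\<lambda>k. p k *\<^sub>R proj (\<phi> k) x) sums reduced_BC \<psi> x"
    using dec by (auto simp: pure_decomposition_def)
  define f where "f k = sqrt (p k) *\<^sub>R \<phi> k" for k
  have form: "(\<lambda>k. (cmod (cinner y (f k)))\<^sup>2) sums (norm (right_bra y \<psi>))\<^sup>2" for y
  proof -
    have "(\<lambda>k. Re (cinner y (p k *\<^sub>R proj (\<phi> k) y))) sums Re (cinner y (reduced_BC \<psi> y))"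
      by (intro sums_Re bounded_linear.sums[OF cinner.bounded_linear_right sums])
    moreover have "Re (cinner y (p k *\<^sub>R proj (\<phi> k) y)) = (cmod (cinner y (f k)))\<^sup>2" for k
    proof -
      have "cmod (cinner (\<phi> k) y) = cmod (cinner y (\<phi> k))"
        by (metis cinner_commute complex_mod_cnj)
      then show ?thesis
        using p(2)[of k] by (simp add: f_def cinner.scaleR_right cinner_proj power_mult_distrib)
    qed
    ultimately show ?thesis by (simp add: reduced_BC_form)
  qed
  \<comment> \<open>One term of the nonnegative series \<open>form\<close>: the domination required
    for the Riesz argument.\<close>
  have "cmod (cinner y (f k)) \<le> norm (right_bra y \<psi>)" for k y
  proof (rule power2_le_imp_le)
    show "(cmod (cinner y (f k)))\<^sup>2 \<le> (norm (right_bra y \<psi>))\<^sup>2"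
      using sum_le_suminf[OF sums_summable[OF form[of y]], of "{k}"] sums_unique[OF form[of y]] by simp
  qed simp
  then have "\<exists>m Y. left_bra m \<psi> = f k \<and> (\<lambda>n. right_bra (Y n) \<psi>) \<longlonglongrightarrow> m" for k
    using steering_vector[of "f k" \<psi>] by metis
  then obtain m Y where m: "\<And>k. left_bra (m k) \<psi> = f k" and Y: "\<And>k. (\<lambda>n. right_bra (Y k n) \<psi>) \<longlonglongrightarrow> m k"
    by metis
  have bessel: "(\<Sum>k\<in>F. (cmod (cinner (m k) (right_bra y \<psi>)))\<^sup>2) \<le> (norm (right_bra y \<psi>))\<^sup>2"
    if "finite F" for F y
  proof -
    have "cinner (m k) (right_bra y \<psi>) = cinner y (f k)" for k
      by (metis m cinner_tensor_left_bra cinner_tensor_right_bra)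
    then show ?thesis
      using sum_le_suminf[OF sums_summable[OF form[of y]] that] sums_unique[OF form[of y]] by simp
  qed
  obtain M where M: "povm M" "\<And>i. M (Suc i) = proj (m i)"
    using povm_completion[of m] Bessel_from_range[OF _ Y bessel] by metis
  \<comment> \<open>The same \<epsilon> serves all \<open>k\<close>, because the errors are weighted
    by \<open>p\<close>, which sums to 1.\<close>
  have "\<exists>\<xi>. norm \<xi> = 1 \<and> max_overlap (\<phi> k) - \<epsilon> < (norm (left_bra \<xi> (\<phi> k)))\<^sup>2" for k
    using max_overlap_approx[OF \<open>0 < \<epsilon>\<close>, of "\<phi> k"] by metis
  then obtain \<xi> where \<xi>: "\<And>k. norm (\<xi> k) = 1"
    "\<And>k. max_overlap (\<phi> k) - \<epsilon> < (norm (left_bra (\<xi> k) (\<phi> k)))\<^sup>2"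
    by metis
  \<comment> \<open>On the complementary outcome any state will do; its contribution is
    nonnegative.\<close>
  define \<mu> where "\<mu> i = (case i of 0 \<Rightarrow> proj (ket undefined) | Suc k \<Rightarrow> proj (\<xi> k))" for i
  have \<mu>: "density_op (\<mu> i)" for i
    by (cases i) (simp_all add: \<mu>_def density_op_proj \<xi>)
  define t where "t i = Re (trace ((M i \<otimes>\<^sub>o \<mu> i) \<circ> reduced_AB \<psi>))" for i
  \<comment> \<open>The opposite direction supplies convergence; without it \<open>suminf\<close>
    would say nothing about its terms.\<close>
  have t: "summable t"
    unfolding t_def[abs_def] by (rule povm_imp_pure_decomposition[OF M(1) \<mu> \<psi>])
  have t0: "0 \<le> t i" for i
    unfolding t_def using M(1) \<mu> by (intro trace_reduced_AB_nonneg) (auto simp: povm_def density_op_def)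
  have le: "p k * max_overlap (\<phi> k) - p k * \<epsilon> \<le> t (Suc k)" for k
  proof -
    have "t (Suc k) = (norm (left_bra (\<xi> k) (f k)))\<^sup>2"
      by (simp add: t_def M(2) \<mu>_def trace_proj_proj m)
    also have "\<dots> = p k * (norm (left_bra (\<xi> k) (\<phi> k)))\<^sup>2"
      using p(2)[of k] by (simp add: f_def bounded_clinear_simps[OF bounded_clinear_left_bra] power_mult_distrib)
    finally show ?thesis
      using mult_left_mono[OF less_imp_le[OF \<xi>(2)] p(2), of k k] by (simp add: right_diff_distrib)
  qed
  have *: "(\<lambda>k. p k * max_overlap (\<phi> k) - p k * \<epsilon>) sums ((\<Sum>k. p k * max_overlap (\<phi> k)) - 1 * \<epsilon>)"
    by (intro sums_diff sums_mult2 p(1) summable_sums pure_decomposition_sums(1)[OF dec])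
  have "1 - (\<Sum>k. p k * geom_ent_pure (\<phi> k)) - \<epsilon> = (\<Sum>k. p k * max_overlap (\<phi> k) - p k * \<epsilon>)"
    using sums_unique[OF *] pure_decomposition_sums(2)[OF dec] by simp
  also have "\<dots> \<le> (\<Sum>k. t (Suc k))"
    by (rule suminf_le[OF le sums_summable[OF *]]) (use t summable_Suc_iff in blast)
  \<comment> \<open>The complementary outcome 0 is added back.\<close>
  also have "\<dots> \<le> suminf t"
    using suminf_split_head[OF t] t0[of 0] by simp
  finally show ?thesis
    unfolding t_def[abs_def] by (rule that[OF M(1) \<mu>])
qed

text \<open>Completing zero vectors gives the trivial measurement, which shows that the supremum is
  taken over a nonempty set.\<close>

lemma ex_povm: "\<exists>M :: nat \<Rightarrow> 'a ell2 \<Rightarrow> 'a ell2. povm M"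
  using povm_completion[of "\<lambda>_. 0 :: 'a ell2"] by (simp add: proj_def) metis

theorem theorem2:
  fixes \<psi> :: "('a \<times> 'b \<times> 'c) ell2"
  assumes "norm \<psi> = 1"
  shows "fidelity_A_to_B (reduced_AB \<psi>) + geom_ent (reduced_BC \<psi>) = 1"
proof -
  define X where "X = {\<Sum>i. Re (trace ((M i \<otimes>\<^sub>o \<mu> i) \<circ> reduced_AB \<psi>)) | M \<mu>. povm M \<and> (\<forall>i. density_op (\<mu> i))}"
  define Z where "Z = {\<Sum>i. p i * geom_ent_pure (\<phi> i) | p \<phi>. pure_decomposition (reduced_BC \<psi>) p \<phi>}"
  have XZ: "\<exists>z\<in>Z. x \<le> 1 - z" if "x \<in> X" for x
  proof -
    obtain M \<mu> where M: "povm M" "\<And>i. density_op (\<mu> i)"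
      and x: "x = (\<Sum>i. Re (trace ((M i \<otimes>\<^sub>o \<mu> i) \<circ> reduced_AB \<psi>)))"
      using \<open>x \<in> X\<close> unfolding X_def by blast
    show ?thesis
    proof (rule povm_imp_pure_decomposition[OF M assms])
      fix p \<phi>
      assume "pure_decomposition (reduced_BC \<psi>) p \<phi>"
        and "(\<Sum>i. Re (trace ((M i \<otimes>\<^sub>o \<mu> i) \<circ> reduced_AB \<psi>))) \<le> 1 - (\<Sum>k. p k * geom_ent_pure (\<phi> k))"
      then show ?thesis unfolding Z_def x by blast
    qed
  qed
  have ZX: "\<exists>x\<in>X. 1 - z - \<epsilon> \<le> x" if "z \<in> Z" "0 < \<epsilon>" for z \<epsilon>
  proof -
    obtain p \<phi> where dec: "pure_decomposition (reduced_BC \<psi>) p \<phi>"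
      and z: "z = (\<Sum>k. p k * geom_ent_pure (\<phi> k))"
      using \<open>z \<in> Z\<close> unfolding Z_def by blast
    show ?thesis
    proof (rule pure_decomposition_imp_povm[OF dec assms \<open>0 < \<epsilon>\<close>])
      fix M \<mu>
      assume "povm M" "\<And>i. density_op (\<mu> i)"
        and "1 - (\<Sum>k. p k * geom_ent_pure (\<phi> k)) - \<epsilon> \<le> (\<Sum>i. Re (trace ((M i \<otimes>\<^sub>o \<mu> i) \<circ> reduced_AB \<psi>)))"
      then show ?thesis unfolding X_def z by blast
    qed
  qed
  have Z0: "0 \<le> z" if "z \<in> Z" for z
    using that pure_decomposition_sums(3) unfolding Z_def by blast
  obtain M where M: "povm (M :: nat \<Rightarrow> 'a ell2 \<Rightarrow> 'a ell2)" using ex_povm by blast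
  define \<mu> :: "nat \<Rightarrow> 'b ell2 \<Rightarrow> 'b ell2" where "\<mu> = (\<lambda>_. proj (ket undefined))"
  have "(\<Sum>i. Re (trace ((M i \<otimes>\<^sub>o \<mu> i) \<circ> reduced_AB \<psi>))) \<in> X"
    unfolding X_def
    by (intro CollectI exI[of _ M] exI[of _ \<mu>]) (simp add: M \<mu>_def density_op_proj)
  then have X: "X \<noteq> {}" by blast
  \<comment> \<open>A countable pure decomposition exists because any measurement steers to
    one.\<close>
  then have Z: "Z \<noteq> {}" using XZ by blast
  have bddZ: "bdd_below Z" using Z0 by (rule bdd_belowI)
  have bddX: "bdd_above X"
    by (rule bdd_aboveI[of _ 1]) (use XZ Z0 in fastforce)
  have "Sup X \<le> 1 - Inf Z"
  proof (rule cSup_least[OF X])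
    fix x assume "x \<in> X"
    then obtain z where "z \<in> Z" "x \<le> 1 - z" using XZ by blast
    then show "x \<le> 1 - Inf Z" using cInf_lower[OF _ bddZ, of z] by simp
  qed
  moreover have "1 - Sup X \<le> Inf Z"
  \<comment> \<open>The slack \<epsilon> absorbs Bob's merely near-optimal states; attainment of the
    extrema is never assumed.\<close>
  proof (rule cInf_greatest[OF Z], rule field_le_epsilon)
    fix z \<epsilon> :: real assume "z \<in> Z" "0 < \<epsilon>"
    then obtain x where "x \<in> X" "1 - z - \<epsilon> \<le> x" using ZX by blast
    then show "1 - Sup X \<le> z + \<epsilon>" using cSup_upper[OF _ bddX, of x] by simp
  qed
  ultimately show ?thesis
    unfolding fidelity_A_to_B_def geom_ent_def by (fold X_def Z_def) simp
qed

end
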